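(* For every integer $r\ge 5$ there exists a continuum of (pairwise non-isomorphic) quasi-isohedral polycycles whose interior faces are $r$-gons, i.e. $(r,q)$-polycycles (for some $q$) that are not isohedral but in which all $r$-gons have the same 1-corona.
   Context: An $(r,q)$-polycycle is a simple planar 2-(vertex-)connected finite or countable graph $G$ of girth $r$ and maximal vertex-degree at most $q$ which admits an $(r,q)$-polycyclic realization $P(G)$ on the plane. This is a plane realization in which: (1) all interior vertices have degree $q$; (2) all interior faces are combinatorial $r$-gons; (3) all vertices, edges and interior faces form a cell-complex, i.e. the intersection of any two faces is an edge, a vertex or $\emptyset$. Interior vertices are those not lying on the boundary of the realization. A polycycle $G$ is isohedral if its automorphism group is transitive on its interior faces. The 1-corona of an $r$-gon of a polycycle is the configuration consisting of this $r$-gon together with all interior faces of the polycycle meeting it. All $r$-gons have the same 1-corona if for any two $r$-gons there is a combinatorial isomorphism (possibly orientation-reversing) between their 1-coronas taking one $r$-gon to the other. *)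

theory Defs
  imports "HOL-Analysis.Analysis" "HOL-Library.Equipollence"
begin

section \<open>Simple graphs\<close>

record 'v graph =
  verts :: "'v set"
  edges :: "'v set set"

definition simple_graph :: "'v graph \<Rightarrow> bool" where
  "simple_graph G \<longleftrightarrow> (\<forall>e\<in>edges G. e \<subseteq> verts G \<and> card e = 2)"

definition incident :: "'v graph \<Rightarrow> 'v \<Rightarrow> 'v set set" where
  "incident G v = {e \<in> edges G. v \<in> e}"

text \<open>Finiteness is required separately because the cardinality of an infinite set is 0.\<close>

definition max_degree_at_most :: "'v graph \<Rightarrow> nat \<Rightarrow> bool" where
  "max_degree_at_most G q \<longleftrightarrow> (\<forall>v\<in>verts G. finite (incident G v) \<and> card (incident G v) \<le> q)"

definition connected_within :: "'v graph \<Rightarrow> 'v set \<Rightarrow> bool" where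
  "connected_within G W \<longleftrightarrow>
     (\<forall>u\<in>W. \<forall>v\<in>W. (u, v) \<in> {(x, y). x \<in> W \<and> y \<in> W \<and> {x, y} \<in> edges G}\<^sup>*)"

definition two_connected :: "'v graph \<Rightarrow> bool" where
  "two_connected G \<longleftrightarrow>
     (infinite (verts G) \<or> card (verts G) \<ge> 3) \<and>
     connected_within G (verts G) \<and>
     (\<forall>v\<in>verts G. connected_within G (verts G - {v}))"

definition cycle_edges :: "'v list \<Rightarrow> 'v set set" where
  "cycle_edges c = {{c ! i, c ! (Suc i mod length c)} | i. i < length c}"

definition is_cycle :: "'v graph \<Rightarrow> 'v list \<Rightarrow> bool" where
  "is_cycle G c \<longleftrightarrow>
     length c \<ge> 3 \<and> distinct c \<and> set c \<subseteq> verts G \<and> cycle_edges c \<subseteq> edges G"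

definition has_girth :: "'v graph \<Rightarrow> nat \<Rightarrow> bool" where
  "has_girth G r \<longleftrightarrow>
     (\<exists>c. is_cycle G c \<and> length c = r) \<and> (\<forall>c. is_cycle G c \<longrightarrow> r \<le> length c)"

definition graph_iso :: "('v \<Rightarrow> 'w) \<Rightarrow> 'v graph \<Rightarrow> 'w graph \<Rightarrow> bool" where
  "graph_iso \<phi> G H \<longleftrightarrow>
     bij_betw \<phi> (verts G) (verts H) \<and> (`) \<phi> ` edges G = edges H"

definition isomorphic :: "'v graph \<Rightarrow> 'w graph \<Rightarrow> bool" where
  "isomorphic G H \<longleftrightarrow> (\<exists>\<phi>. graph_iso \<phi> G H)"

section \<open>Plane realizations\<close>

text \<open>The plane is the type of complex numbers. A drawing assigns a point to every vertex and
  a point set to every edge.\<close>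

record 'v drawing =
  pt :: "'v \<Rightarrow> complex"
  curve :: "'v set \<Rightarrow> complex set"

text \<open>Realizations of infinite graphs are taken without accumulation points (last clause), so
  that the faces outside the polycycle are exactly the unbounded ones. This loses no polycycle:
  gluing half-planes to the boundary lines of a non-compact polycycle yields a plane.\<close>

definition plane_realization :: "'v graph \<Rightarrow> 'v drawing \<Rightarrow> bool" where
  "plane_realization G D \<longleftrightarrow>
     inj_on (pt D) (verts G) \<and>
     (\<forall>e\<in>edges G. \<exists>g. arc g \<and> path_image g = curve D e \<and>
        {pathstart g, pathfinish g} = pt D ` e) \<and>
     (\<forall>e\<in>edges G. \<forall>v\<in>verts G. pt D v \<in> curve D e \<longrightarrow> v \<in> e) \<and>
     (\<forall>e\<in>edges G. \<forall>e'\<in>edges G. e \<noteq> e' \<longrightarrow> curve D e \<inter> curve D e' \<subseteq> pt D ` (e \<inter> e')) \<and>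
     (\<forall>K. compact K \<longrightarrow>
        finite {v \<in> verts G. pt D v \<in> K} \<and> finite {e \<in> edges G. curve D e \<inter> K \<noteq> {}})"

definition skeleton :: "'v graph \<Rightarrow> 'v drawing \<Rightarrow> complex set" where
  "skeleton G D = pt D ` verts G \<union> (\<Union>e\<in>edges G. curve D e)"

definition interior_faces :: "'v graph \<Rightarrow> 'v drawing \<Rightarrow> complex set set" where
  "interior_faces G D = {F \<in> components (- skeleton G D). bounded F}"

definition face_verts :: "'v graph \<Rightarrow> 'v drawing \<Rightarrow> complex set \<Rightarrow> 'v set" where
  "face_verts G D F = {v \<in> verts G. pt D v \<in> frontier F}"

definition face_edges :: "'v graph \<Rightarrow> 'v drawing \<Rightarrow> complex set \<Rightarrow> 'v set set" where
  "face_edges G D F = {e \<in> edges G. curve D e \<subseteq> frontier F}"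

definition combinatorial_gon :: "nat \<Rightarrow> 'v graph \<Rightarrow> 'v drawing \<Rightarrow> complex set \<Rightarrow> bool" where
  "combinatorial_gon r G D F \<longleftrightarrow>
     (\<exists>c. is_cycle G c \<and> length c = r \<and> frontier F = (\<Union>e\<in>cycle_edges c. curve D e))"

definition realization_boundary :: "'v graph \<Rightarrow> 'v drawing \<Rightarrow> complex set" where
  "realization_boundary G D = frontier (skeleton G D \<union> \<Union>(interior_faces G D))"

definition interior_verts :: "'v graph \<Rightarrow> 'v drawing \<Rightarrow> 'v set" where
  "interior_verts G D = {v \<in> verts G. pt D v \<notin> realization_boundary G D}"

section \<open>Polycycles\<close>

definition polycyclic_realization :: "nat \<Rightarrow> nat \<Rightarrow> 'v graph \<Rightarrow> 'v drawing \<Rightarrow> bool" where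
  "polycyclic_realization r q G D \<longleftrightarrow>
     plane_realization G D \<and>
     (\<forall>v\<in>interior_verts G D. card (incident G v) = q) \<and>
     (\<forall>F\<in>interior_faces G D. combinatorial_gon r G D F) \<and>
     (\<forall>F\<in>interior_faces G D. \<forall>F'\<in>interior_faces G D. F \<noteq> F' \<longrightarrow>
        (\<exists>e\<in>edges G. closure F \<inter> closure F' = curve D e) \<or>
        (\<exists>v\<in>verts G. closure F \<inter> closure F' = {pt D v}) \<or>
        closure F \<inter> closure F' = {})"

definition polycycle :: "nat \<Rightarrow> nat \<Rightarrow> 'v graph \<Rightarrow> bool" where
  "polycycle r q G \<longleftrightarrow>
     simple_graph G \<and> countable (verts G) \<and> two_connected G \<and> has_girth G r \<and>
     max_degree_at_most G q \<and> (\<exists>D. polycyclic_realization r q G D)"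

text \<open>Automorphisms of a polycycle are the graph automorphisms that permute the boundaries of
  the interior faces; this makes a difference only for subgraphs of Platonic solids, whose graph
  automorphisms may exchange interior and exterior faces.\<close>

definition polycycle_automorphism :: "'v graph \<Rightarrow> 'v drawing \<Rightarrow> ('v \<Rightarrow> 'v) \<Rightarrow> bool" where
  "polycycle_automorphism G D \<phi> \<longleftrightarrow>
     graph_iso \<phi> G G \<and>
     (`) ((`) \<phi>) ` (face_edges G D ` interior_faces G D) = face_edges G D ` interior_faces G D"

definition isohedral :: "'v graph \<Rightarrow> 'v drawing \<Rightarrow> bool" where
  "isohedral G D \<longleftrightarrow>
     (\<forall>F\<in>interior_faces G D. \<forall>F'\<in>interior_faces G D.
        \<exists>\<phi>. polycycle_automorphism G D \<phi> \<and> (`) \<phi> ` face_edges G D F = face_edges G D F')"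

definition corona :: "'v graph \<Rightarrow> 'v drawing \<Rightarrow> complex set \<Rightarrow> complex set set" where
  "corona G D F = {F' \<in> interior_faces G D. closure F \<inter> closure F' \<noteq> {}}"

text \<open>The vertices and edges of a configuration of faces are those on the boundaries of its
  faces; edges of the polycycle that merely join two such vertices do not belong to it.\<close>

definition configuration_iso ::
  "'v graph \<Rightarrow> 'v drawing \<Rightarrow> complex set set \<Rightarrow> complex set set \<Rightarrow> ('v \<Rightarrow> 'v) \<Rightarrow> bool" where
  "configuration_iso G D C C' \<phi> \<longleftrightarrow>
     bij_betw \<phi> (\<Union>F\<in>C. face_verts G D F) (\<Union>F\<in>C'. face_verts G D F) \<and>
     (`) \<phi> ` (\<Union>F\<in>C. face_edges G D F) = (\<Union>F\<in>C'. face_edges G D F) \<and>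
     (`) ((`) \<phi>) ` (face_edges G D ` C) = face_edges G D ` C'"

definition same_coronas :: "'v graph \<Rightarrow> 'v drawing \<Rightarrow> bool" where
  "same_coronas G D \<longleftrightarrow>
     (\<forall>F\<in>interior_faces G D. \<forall>F'\<in>interior_faces G D.
        \<exists>\<phi>. configuration_iso G D (corona G D F) (corona G D F') \<phi> \<and>
            (`) \<phi> ` face_edges G D F = face_edges G D F')"

definition quasi_isohedral_polycycle :: "nat \<Rightarrow> nat \<Rightarrow> 'v graph \<Rightarrow> bool" where
  "quasi_isohedral_polycycle r q G \<longleftrightarrow>
     polycycle r q G \<and>
     (\<exists>D. polycyclic_realization r q G D \<and> \<not> isohedral G D \<and> same_coronas G D)"

end

(* Glue r-gons into a two-sided infinite strip such that the edges shared with the two neighbours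
   are separated by a single edge on one side of the strip, hence by r - 3 edges on the other. For
   every r-gon the choice of the short side is free, and it does not influence the 1-corona, since
   r-gons at distance two in the strip are disjoint.

   A finite subgraph of minimum degree 2 contains all vertices of some r-gon: look at its rightmost
   vertices. Hence the girth is r, and isomorphisms map r-gons to r-gons, that is, they act as shifts
   and reflections on the strip. They preserve the places where the short side changes. It remains
   to encode sets of naturals by sequences of short sides such that a shift or reflection matches the
   changes of two such sequences only if it is trivial and the sets agree. *)

theory Submission
  imports Defs
begin

section \<open>Integer points and segments\<close>

text \<open>All vertices lie on the two boundary lines, so the condition on interior vertices is
  void and \<open>q\<close> only has to bound the degree 3. The bound \<open>r \<ge> 5\<close> gives
  the long side \<open>r - 3 \<ge> 2\<close> edges; for \<open>r = 4\<close> both sides would be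
  single edges and there would be nothing to choose. All cells are drawn as equal rectangles and a
  choice of sides merely redistributes vertices along the lines, so faces look the same for all
  choices. The obstacle is that isomorphisms are abstract graph maps that need not come from the
  plane. Faces are therefore recognized without topology, as the sets of \<open>r\<close> vertices
  that induce minimum degree at least 2. Only changes of side can be recovered, never the sides
  themselves, since exchanging the two lines complements the sequence. Hence the codes begin with a
  constant half-line, which fixes an origin, followed by prescribed values from which the rest is
  reconstructed. The resulting rigidity also refutes isohedrality.\<close>

definition vx :: "int \<Rightarrow> bool \<Rightarrow> nat" where
  "vx x y = to_nat (x, y)"

lemma vx_eq_iff [simp]: "vx x y = vx x' y' \<longleftrightarrow> x = x' \<and> y = y'"
  by (simp add: vx_def)

text \<open>The vertices are pairs of an abscissa and a line, coded as naturals because the theorem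
  asks for graphs over \<open>nat\<close>; this decodes them.\<close>

definition P :: "nat \<Rightarrow> complex" where
  "P v = (case from_nat v of (x :: int, y) \<Rightarrow> Complex (of_int x) (of_bool y))"

definition D :: "nat drawing" where
  "D = \<lparr>pt = P, curve = \<lambda>e. convex hull (P ` e)\<rparr>"

lemma P_vx [simp]: "P (vx x y) = Complex (of_int x) (of_bool y)"
  by (simp add: P_def vx_def)

lemma pt_D [simp]: "pt D = P"
  by (simp add: D_def)

lemma curve_D: "curve D {u, v} = closed_segment (P u) (P v)"
  by (simp add: D_def segment_convex_hull)

lemma P_in_curve: "v \<in> e \<Longrightarrow> P v \<in> curve D e"
  by (simp add: D_def hull_inc)

lemma in_curve_horizontal:
  assumes "x \<le> x'"
  shows "z \<in> curve D {vx x y, vx x' y} \<longleftrightarrow> Im z = of_bool y \<and> of_int x \<le> Re z \<and> Re z \<le> of_int x'"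
  using assms by (auto simp: curve_D closed_segment_same_Im closed_segment_eq_real_ivl)

lemma in_curve_rung:
  "z \<in> curve D {vx x False, vx x True} \<longleftrightarrow> Re z = of_int x \<and> 0 \<le> Im z \<and> Im z \<le> 1"
  by (auto simp: curve_D closed_segment_same_Re closed_segment_eq_real_ivl)

text \<open>Serves to keep the two regions beside the strip out of the bounded faces.\<close>

lemma unbounded_halfplanes: "\<not> bounded {z. Im z > 1}" "\<not> bounded {z. Im z < 0}"
proof -
  have no: "\<not> (\<forall>x\<in>S. norm x \<le> b)" if "\<And>t::real. Complex t c \<in> S" for S b c
  proof -
    have "\<bar>b\<bar> + 1 \<le> norm (Complex (\<bar>b\<bar> + 1) c)" using abs_Re_le_cmod[of "Complex (\<bar>b\<bar> + 1) c"] by simp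
    then show ?thesis using that[of "\<bar>b\<bar> + 1"] by force
  qed
  show "\<not> bounded {z. Im z > 1}" using no[of 2 "{z. Im z > 1}"] by (auto simp: bounded_iff)
  show "\<not> bounded {z. Im z < 0}" using no[of "-1" "{z. Im z < 0}"] by (auto simp: bounded_iff)
qed

section \<open>The strip as a graph\<close>

text \<open>\<open>s n\<close> is the side of the strip on which cell \<open>n\<close> has its long side; \<open>True\<close> is the upper line.
  The cells have width \<open>K\<close>, and vertices lie at integer points: all integer points on the long
  sides, but only the end points of the short ones.\<close>

locale ladder =
  fixes r :: nat and s :: "int \<Rightarrow> bool"
  assumes r_ge_5: "r \<ge> 5"
begin

text \<open>An \<open>r\<close>-gon consists of two rungs, one short edge and \<open>K\<close> edges
  on the long side.\<close>

definition K :: int where "K = int r - 3"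

lemma K_ge_2: "K \<ge> 2" and K_pos: "K > 0" and int_r: "int r = K + 3"
  using r_ge_5 by (auto simp: K_def)

definition on :: "int \<Rightarrow> bool \<Rightarrow> bool" where
  "on x y \<longleftrightarrow> K dvd x \<or> s (x div K) = y"

text \<open>The next vertex on the same line, provided that \<open>on x y\<close> holds.\<close>

definition nx :: "int \<Rightarrow> bool \<Rightarrow> int" where
  "nx x y = (if s (x div K) = y then x + 1 else x + K)"

definition G :: "nat graph" where
  "G = \<lparr>verts = {vx x y | x y. on x y},
        edges = {{vx x y, vx (nx x y) y} | x y. on x y} \<union>
                {{vx (K * n) False, vx (K * n) True} | n. True}\<rparr>"

lemma div_bounds: "K * (x div K) \<le> x" "x < K * (x div K) + K"
  using K_pos by (auto simp: mult.commute[of K] pos_mod_bound minus_mod_eq_div_mult[symmetric])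

lemma div_eqI: "K * n \<le> x \<Longrightarrow> x < K * n + K \<Longrightarrow> x div K = n"
  by (metis add_diff_cancel_left' diff_ge_0_iff_ge diff_less_eq int_div_pos_eq le_add_diff_inverse
      add.commute)

lemma div_mult_self [simp]: "K * n div K = n"
  using K_pos by simp

lemma on_mult [simp]: "on (K * n) y"
  by (simp add: on_def)

lemma on_mult_add [simp]: "on (K * n + K) y"
  by (simp add: on_def)

lemma mult_K_le: "K * m \<le> K * n \<longleftrightarrow> m \<le> n"
  using K_pos by simp

lemma less_nx: "x < nx x y"
  using K_pos by (simp add: nx_def)

lemma nx_le: "nx x y \<le> x + K"
  using K_pos by (simp add: nx_def)

lemma on_nx: assumes "on x y" shows "on (nx x y) y"
proof (cases "s (x div K) = y")
  case True
  have "K dvd x + 1 \<or> (x + 1) div K = x div K"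
  proof (cases "x + 1 < K * (x div K) + K")
    case True
    then show ?thesis using div_bounds[of x] by (intro disjI2 div_eqI) auto
  next
    case False
    then have "x + 1 = K * (x div K) + K" using div_bounds[of x] by linarith
    then show ?thesis by (metis dvd_add_triv_right_iff dvd_triv_left)
  qed
  then show ?thesis using True by (auto simp: on_def nx_def)
next
  case False
  then show ?thesis using assms by (auto simp: on_def nx_def)
qed

text \<open>If \<open>nx\<close> jumps by \<open>K\<close>, it starts at a rung and crosses a short
  side, where no vertex lies strictly between the two rungs. So \<open>nx\<close> is the successor
  function on the vertices of a line.\<close>

lemma nx_le_next:
  assumes "on x y" "on x' y" "x < x'"
  shows "nx x y \<le> x'"
proof (cases "s (x div K) = y")
  case True
  then show ?thesis using assms by (simp add: nx_def)
next
  case False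
  then obtain n where n: "x = K * n" using assms(1) by (auto simp: on_def)
  have "K * n + K \<le> x'"
  proof (rule ccontr)
    assume a: "\<not> ?thesis"
    then have "x' div K = n" using assms n by (intro div_eqI) auto
    then obtain m where m: "x' = K * m" using assms(2) False n by (auto simp: on_def)
    then show False using \<open>x' div K = n\<close> assms(3) n by simp
  qed
  then show ?thesis using False n by (simp add: nx_def)
qed

lemma nx_inj: "on x y \<Longrightarrow> on x' y \<Longrightarrow> nx x y = nx x' y \<Longrightarrow> x = x'"
  using nx_le_next[of x y x'] nx_le_next[of x' y x] less_nx[of x y] less_nx[of x' y]
  by (cases x x' rule: linorder_cases) auto

lemma ex_pred: assumes "on x y" shows "\<exists>p. on p y \<and> nx p y = x"
\<comment> \<open>\<open>(x - 1) div K\<close> is the cell immediately to the left of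
  \<open>x\<close>, also when \<open>x\<close> is on a rung and \<open>x div K\<close> is the cell
  to the right.\<close>
proof (cases "s ((x - 1) div K) = y")
  case True
  then show ?thesis by (intro exI[of _ "x - 1"]) (auto simp: on_def nx_def)
next
  case False
  have "K dvd x"
  proof (rule ccontr)
    assume a: "\<not> K dvd x"
    then have "x \<noteq> K * (x div K)" by (metis dvd_triv_left)
    then have "(x - 1) div K = x div K" using div_bounds[of x] by (intro div_eqI) auto
    then show False using assms a False by (auto simp: on_def)
  qed
  then obtain n where n: "x = K * n" by auto
  have "(x - 1) div K = n - 1"
    using n K_pos by (intro div_eqI) (auto simp: algebra_simps)
  then have "\<not> s (K * (n - 1) div K) = y" using False unfolding div_mult_self by simp
  then have "nx (K * (n - 1)) y = K * (n - 1) + K" by (simp only: nx_def if_False)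
  then have "nx (K * (n - 1)) y = x" using n by (simp add: algebra_simps)
  then show ?thesis using on_mult by blast
qed

lemma verts_G: "v \<in> verts G \<longleftrightarrow> (\<exists>x y. v = vx x y \<and> on x y)"
  by (auto simp: G_def)

lemma vx_in_verts [simp]: "vx x y \<in> verts G \<longleftrightarrow> on x y"
  by (auto simp: G_def)

lemma edge_cases:
  assumes "e \<in> edges G"
  obtains (horizontal) x y where "on x y" "e = {vx x y, vx (nx x y) y}"
    | (rung) n where "e = {vx (K * n) False, vx (K * n) True}"
  using assms by (auto simp: G_def)

lemma horizontal_edge [intro]: "on x y \<Longrightarrow> {vx x y, vx (nx x y) y} \<in> edges G"
  by (auto simp: G_def)

lemma rung_edge [intro]: "{vx (K * n) False, vx (K * n) True} \<in> edges G"
  by (auto simp: G_def)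

lemma edges_vx:
  "{vx x y, vx x' y'} \<in> edges G \<longleftrightarrow>
     y = y' \<and> on x y \<and> on x' y' \<and> (x' = nx x y \<or> x = nx x' y') \<or> y \<noteq> y' \<and> x = x' \<and> K dvd x"
  (is "?L \<longleftrightarrow> ?R")
proof
  assume ?L
  then show ?R
    by (cases rule: edge_cases) (auto simp: doubleton_eq_iff on_nx)
next
  assume ?R
  then show ?L
  proof
    assume "y = y' \<and> on x y \<and> on x' y' \<and> (x' = nx x y \<or> x = nx x' y')"
    then show ?L using horizontal_edge[of x y] horizontal_edge[of x' y'] by (auto simp: insert_commute)
  next
    assume "y \<noteq> y' \<and> x = x' \<and> K dvd x"
    then obtain n where "x = K * n" "x' = K * n" "y \<noteq> y'" by auto
    then show ?L using rung_edge[of n] by (cases y; cases y') (auto simp: insert_commute)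
  qed
qed

lemma simple_graph_G: "simple_graph G"
  unfolding simple_graph_def
proof
  fix e assume "e \<in> edges G"
  then show "e \<subseteq> verts G \<and> card e = 2"
  proof (cases rule: edge_cases)
    case (horizontal x y)
    then show ?thesis using less_nx[of x y] on_nx[of x y] by auto
  qed auto
qed

lemma max_degree_G: "max_degree_at_most G 3"
  unfolding max_degree_at_most_def
proof
  fix v assume "v \<in> verts G"
  then obtain x y where v: "v = vx x y" "on x y" by (auto simp: verts_G)
  obtain p where p: "on p y" "nx p y = x" using ex_pred v by blast
  let ?S = "{{vx x y, vx (nx x y) y}, {vx p y, vx x y}, {vx x False, vx x True}}"
  have "incident G v \<subseteq> ?S"
  proof
    fix e assume "e \<in> incident G v"
    then have e: "e \<in> edges G" "v \<in> e" by (auto simp: incident_def)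
    from e(1) show "e \<in> ?S"
    proof (cases rule: edge_cases)
      case (horizontal x' y')
      then have "y' = y" "x' = x \<or> nx x' y = x" using e(2) v by auto
      then show ?thesis using horizontal p nx_inj[of x' y p] by auto
    qed (use e v in auto)
  qed
  moreover have "card ?S \<le> 3" by (simp add: card_insert_if)
  ultimately show "finite (incident G v) \<and> card (incident G v) \<le> 3"
    by (meson card_mono finite.emptyI finite.insertI finite_subset order_trans)
qed

section \<open>Two-connectedness\<close>

abbreviation walk :: "nat set \<Rightarrow> (nat \<times> nat) set" where
  "walk W \<equiv> {(a, b). a \<in> W \<and> b \<in> W \<and> {a, b} \<in> edges G}\<^sup>*"

lemma walk_sym: "(a, b) \<in> walk W \<Longrightarrow> (b, a) \<in> walk W"
  by (rule symD[OF sym_rtrancl]) (auto intro: symI simp: insert_commute)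

lemma walk_line:
  assumes "on x y" "on x' y" "x \<le> x'" "\<And>t. on t y \<Longrightarrow> x \<le> t \<Longrightarrow> t \<le> x' \<Longrightarrow> vx t y \<in> W"
  shows "(vx x y, vx x' y) \<in> walk W"
  using assms
proof (induction "nat (x' - x)" arbitrary: x rule: less_induct)
  case less
  show ?case
  proof (cases "x = x'")
    case False
    then have le: "nx x y \<le> x'" using less nx_le_next by auto
    have "(vx (nx x y) y, vx x' y) \<in> walk W"
      using le less_nx[of x y] less.prems on_nx by (intro less.hyps) auto
    moreover have "(vx x y, vx (nx x y) y) \<in> walk W"
      using less.prems le on_nx[of x y] less_nx[of x y] by (intro r_into_rtrancl) auto
    ultimately show ?thesis by simp
  qed simp
qed

text \<open>Deleting a vertex of one line leaves the other line intact. Every remaining vertex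
  reaches that line by walking away from the deleted vertex to the next rung.\<close>

lemma connected_minus: "connected_within G (verts G - {vx X Y})"
proof -
  let ?W = "verts G - {vx X Y}"
  have line: "(vx x (\<not> Y), vx x' (\<not> Y)) \<in> walk ?W" if "on x (\<not> Y)" "on x' (\<not> Y)" for x x'
  proof (cases "x \<le> x'")
    case True
    then show ?thesis using that by (intro walk_line) auto
  next
    case False
    then show ?thesis using that by (intro walk_sym[OF walk_line]) auto
  qed
  have cross: "(vx (K * n) Y, vx (K * n) (\<not> Y)) \<in> walk ?W" if "K * n \<noteq> X" for n
    using that by (intro r_into_rtrancl) (auto simp: edges_vx)
  have to_line: "\<exists>x. on x (\<not> Y) \<and> (u, vx x (\<not> Y)) \<in> walk ?W" if uW: "u \<in> ?W" for u
  proof -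
    obtain x y where u: "u = vx x y" "on x y" using uW by (auto simp: verts_G)
    show ?thesis
    proof (cases "y = Y")
      case False
      then have "y = (\<not> Y)" by auto
      then show ?thesis using u by auto
    next
      case y: True
      then have "x \<noteq> X" using u uW by auto
      then consider "x < X" | "X < x" by linarith
      then show ?thesis
      proof cases
        case 1
        let ?n = "x div K"
        have "(vx (K * ?n) Y, vx x Y) \<in> walk ?W"
          using 1 u y div_bounds[of x] by (intro walk_line) auto
        moreover have "K * ?n \<noteq> X" using div_bounds[of x] 1 by auto
        ultimately show ?thesis using cross[of ?n] walk_sym u y
          by (meson on_mult rtrancl_trans)
      next
        case 2
        let ?n = "x div K + 1"
        have b: "x < K * ?n" using div_bounds[of x] by (simp add: algebra_simps)
        have "(vx x Y, vx (K * ?n) Y) \<in> walk ?W"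
          using 2 u y b by (intro walk_line) auto
        moreover have "K * ?n \<noteq> X" using b 2 by auto
        ultimately show ?thesis using cross[of ?n] u y
          by (meson on_mult rtrancl_trans)
      qed
    qed
  qed
  show ?thesis
    unfolding connected_within_def
  proof (intro ballI)
    fix u v assume "u \<in> ?W" "v \<in> ?W"
    then obtain a b where "on a (\<not> Y)" "on b (\<not> Y)"
        "(u, vx a (\<not> Y)) \<in> walk ?W" "(v, vx b (\<not> Y)) \<in> walk ?W"
      using to_line by meson
    then show "(u, v) \<in> walk ?W"
      using line walk_sym by (meson rtrancl_trans)
  qed
qed

lemma infinite_verts: "infinite (verts G)"
proof
  assume "finite (verts G)"
  moreover have "range (\<lambda>n. vx (K * n) True) \<subseteq> verts G" by auto
  ultimately have "finite (range (\<lambda>n. vx (K * n) True))" by (rule finite_subset[rotated])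
  moreover have "inj (\<lambda>n. vx (K * n) True)" using K_pos by (auto simp: inj_def)
  ultimately show False using finite_imageD infinite_UNIV_int by blast
qed

lemma two_connected_G: "two_connected G"
proof -
  \<comment> \<open>A name that is no vertex: abscissa 1 lies strictly inside the short side of cell
    0, because \<open>K \<ge> 2\<close>. Deleting it changes nothing, so
    \<open>connected_minus\<close> also yields connectedness of the whole graph.\<close>
  have "\<not> on 1 (\<not> s 0)"
    using K_ge_2 by (auto simp: on_def)
  then have "verts G - {vx 1 (\<not> s 0)} = verts G" by auto
  then show ?thesis
    using connected_minus infinite_verts by (metis two_connected_def verts_G)
qed


section \<open>Cells and girth\<close>

definition face_vs :: "int \<Rightarrow> nat set" where
  "face_vs n = {vx x y | x y. on x y \<and> K * n \<le> x \<and> x \<le> K * n + K}"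

text \<open>The boundary is numbered along the long side from left to right and back along the short
  side. Hence the left rung always has the indices \<open>r - 1\<close> and \<open>0\<close>, the
  right rung \<open>r - 3\<close> and \<open>r - 2\<close>, on whichever line the long side
  is.\<close>

definition pos :: "int \<Rightarrow> nat \<Rightarrow> nat" where
  "pos n i = (if int i \<le> K then vx (K * n + int i) (s n)
              else if int i = K + 1 then vx (K * n + K) (\<not> s n) else vx (K * n) (\<not> s n))"

lemma on_face_long: "K * n \<le> x \<Longrightarrow> x \<le> K * n + K \<Longrightarrow> on x (s n)"
  using div_eqI[of n x] by (cases "x = K * n + K") (auto simp: on_def)

lemma on_face_short:
  assumes "K * n \<le> x" "x \<le> K * n + K" "on x (\<not> s n)"
  shows "x = K * n \<or> x = K * n + K"
proof (rule ccontr)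
  assume a: "\<not> ?thesis"
  then have "x div K = n" using assms by (intro div_eqI) auto
  moreover have "K dvd x" using assms calculation by (auto simp: on_def)
  ultimately show False using a by auto
qed

lemma vx_in_face_vs: "vx x y \<in> face_vs n \<longleftrightarrow> on x y \<and> K * n \<le> x \<and> x \<le> K * n + K"
  by (auto simp: face_vs_def)

lemma inj_pos: "inj_on (pos n) {..<r}"
  using int_r K_pos by (auto simp: inj_on_def pos_def split: if_splits)

lemma pos_image: "pos n ` {..<r} = face_vs n"
proof
  show "pos n ` {..<r} \<subseteq> face_vs n"
    using K_pos by (auto simp: pos_def vx_in_face_vs on_face_long)
  show "face_vs n \<subseteq> pos n ` {..<r}"
  proof
    fix v assume "v \<in> face_vs n"
    then obtain x y where v: "v = vx x y" "on x y" "K * n \<le> x" "x \<le> K * n + K"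
      by (auto simp: face_vs_def)
    show "v \<in> pos n ` {..<r}"
    proof (cases "y = s n")
      case True
      then have "v = pos n (nat (x - K * n))" using v by (simp add: pos_def)
      then show ?thesis using v int_r by (intro image_eqI) auto
    next
      case False
      then have y: "y = (\<not> s n)" by auto
      then consider "x = K * n" | "x = K * n + K" using on_face_short v by blast
      then show ?thesis
      proof cases
        case 1
        then have "v = pos n (nat (K + 2))" using v y K_pos by (simp add: pos_def)
        then show ?thesis using K_pos int_r by (intro image_eqI) auto
      next
        case 2
        then have "v = pos n (nat (K + 1))" using v y K_pos by (simp add: pos_def)
        then show ?thesis using K_pos int_r by (intro image_eqI) auto
      qed
    qed
  qed
qed

lemma card_face_vs: "card (face_vs n) = r"
  using card_image[OF inj_pos[of n]] by (simp add: pos_image)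

lemma face_vs_subset: "face_vs n \<subseteq> verts G"
  by (auto simp: face_vs_def)

text \<open>Stated for an arbitrary labelling, so that it also applies to the relabelled traversals
  in the coronas.\<close>

definition pos_edges :: "(nat \<Rightarrow> nat) \<Rightarrow> nat set set" where
  "pos_edges f = {{f i, f (Suc i mod r)} | i. i < r}"

lemma nx_long: "K * n \<le> x \<Longrightarrow> x < K * n + K \<Longrightarrow> nx x (s n) = x + 1"
  using div_eqI[of n x] by (simp add: nx_def)

lemma nx_short: "nx (K * n) (\<not> s n) = K * n + K"
  by (simp add: nx_def)

lemma rung_edge_mult: "{vx (K * n) y, vx (K * n) (\<not> y)} \<in> edges G"
  by (simp add: edges_vx)

lemma rung_edge_add: "{vx (K * n + K) y, vx (K * n + K) (\<not> y)} \<in> edges G"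
  by (simp add: edges_vx)

lemma pos_edge: assumes "i < r" shows "{pos n i, pos n (Suc i mod r)} \<in> edges G"
proof -
  consider "int i < K" | "int i = K" | "int i = K + 1" | "int i = K + 2"
    using assms int_r by linarith
  then show ?thesis
  proof cases
    case 1
    then have "Suc i mod r = Suc i" using int_r by simp
    then show ?thesis using 1 nx_long[of n "K * n + int i"]
      by (simp add: pos_def edges_vx on_face_long add.assoc add.commute[of 1])
  next
    case 2
    then have "Suc i mod r = Suc i" using int_r by simp
    then show ?thesis using 2 rung_edge_add by (simp add: pos_def)
  next
    case 3
    then have "Suc i mod r = Suc i" using int_r by simp
    then show ?thesis using 3 horizontal_edge[OF on_mult, of n "\<not> s n"]
      by (simp add: pos_def nx_short insert_commute)
  next
    case 4
    then have "Suc i = r" using int_r by linarith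
    then show ?thesis using 4 rung_edge_mult[of n "\<not> s n"] K_pos by (simp add: pos_def)
  qed
qed

text \<open>Faces have no chords. Thus the edge set of a face is determined by its vertex set, and
  later arguments can work with vertex sets alone.\<close>

lemma pos_edges_pos: "pos_edges (pos n) = {e \<in> edges G. e \<subseteq> face_vs n}"
proof
  show "pos_edges (pos n) \<subseteq> {e \<in> edges G. e \<subseteq> face_vs n}"
    using pos_edge pos_image[of n] r_ge_5 by (fastforce simp: pos_edges_def)
  show "{e \<in> edges G. e \<subseteq> face_vs n} \<subseteq> pos_edges (pos n)"
  proof
    fix e assume "e \<in> {e \<in> edges G. e \<subseteq> face_vs n}"
    then have e: "e \<in> edges G" "e \<subseteq> face_vs n" by auto
    from e(1) have "\<exists>i<r. e = {pos n i, pos n (Suc i mod r)}"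
    proof (cases rule: edge_cases)
      case (horizontal x y)
      then have b: "K * n \<le> x" "nx x y \<le> K * n + K" using e by (auto simp: vx_in_face_vs)
      then have b': "x < K * n + K" using less_nx[of x y] by simp
      show ?thesis
      proof (cases "y = s n")
        case True
        have l: "Suc (nat (x - K * n)) < r" using int_r b' b by linarith
        show ?thesis
          using l b b' horizontal nx_long[of n x] True
          by (intro exI[of _ "nat (x - K * n)"]) (auto simp: pos_def)
      next
        case False
        then have "x = K * n" using on_face_short[of n x] b b' horizontal by auto
        then show ?thesis using False horizontal nx_short[of n] K_pos int_r
          by (intro exI[of _ "nat (K + 1)"]) (auto simp: pos_def insert_commute)
      qed
    next
      case (rung m)
      then have "K * n \<le> K * m" "K * m \<le> K * n + K" using e by (auto simp: vx_in_face_vs)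
      then have "K * n \<le> K * m" "K * m \<le> K * (n + 1)" by (simp_all add: distrib_left)
      then have "m = n \<or> m = n + 1" unfolding mult_K_le by linarith
      then show ?thesis
      proof
        assume m: "m = n"
        have "Suc (nat (K + 2)) = r" using K_pos int_r by linarith
        then show ?thesis using m rung K_pos int_r
          by (intro exI[of _ "nat (K + 2)"]) (cases "s n"; auto simp: pos_def)
      next
        assume m: "m = n + 1"
        have "Suc (nat K) < r" using K_pos int_r by linarith
        then show ?thesis using m rung K_pos int_r
          by (intro exI[of _ "nat K"]) (cases "s n"; auto simp: pos_def distrib_left)
      qed
    qed
    then show "e \<in> pos_edges (pos n)" by (auto simp: pos_edges_def)
  qed
qed

definition face_list :: "int \<Rightarrow> nat list" where
  "face_list n = map (pos n) [0..<r]"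

lemma cycle_edges_face_list: "cycle_edges (face_list n) = pos_edges (pos n)"
proof -
  have "face_list n ! i = pos n i" if "i < r" for i
    using that by (simp add: face_list_def)
  moreover have "length (face_list n) = r"
    by (simp add: face_list_def)
  ultimately show ?thesis
    unfolding cycle_edges_def pos_edges_def setcompr_eq_image
    using r_ge_5 by (intro image_cong) auto
qed

lemma length_face_list: "length (face_list n) = r"
  by (simp add: face_list_def)

lemma is_cycle_face_list: "is_cycle G (face_list n)"
proof -
  have "set (face_list n) = face_vs n"
    using pos_image[of n] by (simp add: face_list_def atLeast0LessThan)
  moreover have "distinct (face_list n)"
    using inj_pos[of n] by (simp add: face_list_def distinct_map atLeast0LessThan)
  ultimately show ?thesis
    using r_ge_5 face_vs_subset[of n] pos_edges_pos[of n]
    by (auto simp: is_cycle_def length_face_list cycle_edges_face_list)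
qed

end

section \<open>Finite subgraphs of minimum degree 2\<close>

text \<open>Weaker than being the vertex set of a cycle, but strong enough to find a face inside,
  and transported by isomorphisms without any cyclic order.\<close>

definition core :: "'v graph \<Rightarrow> 'v set \<Rightarrow> bool" where
  "core G C \<longleftrightarrow> finite C \<and> C \<noteq> {} \<and> C \<subseteq> verts G \<and>
     (\<forall>v\<in>C. \<exists>a\<in>C. \<exists>b\<in>C. a \<noteq> b \<and> {v, a} \<in> edges G \<and> {v, b} \<in> edges G)"

lemma core_cycle:
  assumes "is_cycle G c"
  shows "core G (set c)"
proof -
  let ?l = "length c"
  have l: "?l \<ge> 3" and d: "distinct c" and v: "set c \<subseteq> verts G" and e: "cycle_edges c \<subseteq> edges G"
    using assms by (auto simp: is_cycle_def)
  have "\<exists>a\<in>set c. \<exists>b\<in>set c. a \<noteq> b \<and> {c ! i, a} \<in> edges G \<and> {c ! i, b} \<in> edges G" if i: "i < ?l" for i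
  proof -
    \<comment> \<open>\<open>j\<close> and \<open>k\<close> are the cyclic predecessor and successor
      of \<open>i\<close>; they differ because the length is at least 3.\<close>
    define j where "j = (if i = 0 then ?l - 1 else i - 1)"
    define k where "k = Suc i mod ?l"
    have j: "j < ?l" "Suc j mod ?l = i" using i l by (auto simp: j_def)
    have k: "k < ?l" using i unfolding k_def by (intro mod_less_divisor) linarith
    have "k = (if Suc i = ?l then 0 else Suc i)" using i by (simp add: k_def)
    then have jk: "j \<noteq> k" using i l by (auto simp: j_def split: if_splits)
    have "{c ! i, c ! k} \<in> edges G" using e i by (auto simp: cycle_edges_def k_def)
    moreover have "{c ! i, c ! j} \<in> edges G"
    proof -
      have "{c ! j, c ! (Suc j mod ?l)} \<in> edges G" using e j(1) by (auto simp: cycle_edges_def)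
      then show ?thesis by (simp add: j(2) insert_commute)
    qed
    moreover have "c ! j \<noteq> c ! k" using jk j k d by (simp add: nth_eq_iff_index_eq)
    ultimately show ?thesis using j k nth_mem by metis
  qed
  then have "\<forall>v\<in>set c. \<exists>a\<in>set c. \<exists>b\<in>set c. a \<noteq> b \<and> {v, a} \<in> edges G \<and> {v, b} \<in> edges G"
    by (metis in_set_conv_nth)
  moreover have "set c \<noteq> {}" using l by auto
  ultimately show ?thesis using v by (simp add: core_def)
qed

context ladder
begin

lemma core_face_vs: "core G (face_vs n)"
proof -
  have "set (face_list n) = face_vs n"
    using pos_image[of n] by (simp add: face_list_def atLeast0LessThan)
  then show ?thesis using core_cycle[OF is_cycle_face_list, of n] by simp
qed

text \<open>A vertex has only three possible neighbours: left, right, and across a rung if there is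
  one. The disjuncts list the ways to choose two of them.\<close>

lemma core_neighbours:
  assumes "core G C" "vx x y \<in> C" "on p y" "nx p y = x"
  shows "vx p y \<in> C \<and> (vx (nx x y) y \<in> C \<or> vx x (\<not> y) \<in> C \<and> K dvd x) \<or>
         vx (nx x y) y \<in> C \<and> vx x (\<not> y) \<in> C \<and> K dvd x"
proof -
  have nb: "a = vx p y \<or> a = vx (nx x y) y \<or> a = vx x (\<not> y) \<and> K dvd x"
    if aC: "a \<in> C" and ae: "{vx x y, a} \<in> edges G" for a
  proof -
    have "a \<in> verts G" using assms(1) aC by (auto simp: core_def)
    then obtain x' y' where a: "a = vx x' y'" "on x' y'"
      by (auto simp: verts_G)
    then show ?thesis using ae nx_inj[of x' y p] assms by (auto simp: edges_vx)
  qed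
  obtain a b where "a \<in> C" "b \<in> C" "a \<noteq> b" "{vx x y, a} \<in> edges G" "{vx x y, b} \<in> edges G"
    using assms(1,2) unfolding core_def by meson
  then show ?thesis using nb[of a] nb[of b] by metis
qed

text \<open>At a vertex of maximal abscissa both the rung and the edge to the left must be used, and
  following the two sides to the left from there one collects a whole face.\<close>

lemma core_contains_face:
  assumes C: "core G C"
  shows "\<exists>n. face_vs n \<subseteq> C"
proof -
  define S where "S = {x. \<exists>y. vx x y \<in> C}"
  have sub: "C \<subseteq> verts G" and finC: "finite C" and neC: "C \<noteq> {}" using C by (auto simp: core_def)
  have "S \<subseteq> (\<lambda>v. fst (from_nat v :: int \<times> bool)) ` C"
    by (force simp: S_def vx_def)
  then have fin: "finite S" using finC by (rule finite_surj[rotated])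
  obtain v where "v \<in> C" "v \<in> verts G" using neC sub by auto
  then have ne: "S \<noteq> {}" by (auto simp: S_def verts_G)
  define X where "X = Max S"
  have max: "x \<le> X" if "vx x y \<in> C" for x y
    using fin that by (auto simp: X_def S_def intro!: Max_ge)
  have step: "vx X (\<not> y) \<in> C \<and> K dvd X \<and> vx p y \<in> C"
    if "vx X y \<in> C" "on p y" "nx p y = X" for y p
    using core_neighbours[OF C that] max[of "nx X y" y] less_nx[of X y] by auto
  obtain y0 where y0: "vx X y0 \<in> C" using Max_in[OF fin ne] by (auto simp: X_def S_def)
  then have "on X y0" using sub by (auto simp: verts_G)
  then obtain p0 where "on p0 y0" "nx p0 y0 = X" using ex_pred by blast
  then have "vx X (\<not> y0) \<in> C" and dvd: "K dvd X" using step[OF y0] by blast+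
  then have X: "vx X y \<in> C" for y using y0 by (cases "y = y0") auto
  obtain m where m: "X = K * m" using dvd by auto
  \<comment> \<open>The face to be collected is the one to the left of the rung at
    \<open>X\<close>.\<close>
  define n where "n = m - 1"
  have Xn: "X = K * n + K" by (simp add: m n_def algebra_simps)
  have short: "vx (K * n) (\<not> s n) \<in> C"
    using step[OF X, of "K * n" "\<not> s n"] nx_short[of n] Xn by simp
  have long: "vx (K * n + K - int i) (s n) \<in> C" if "int i \<le> K" for i
    using that
  proof (induction i)
    case 0
    then show ?case using X Xn by simp
  next
    case (Suc i)
    let ?x = "K * n + K - int i" and ?p = "K * n + K - int (Suc i)"
    have IH: "vx ?x (s n) \<in> C" using Suc by simp
    have b: "K * n \<le> ?p" "?p < K * n + K" using Suc.prems by auto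
    have p: "on ?p (s n)" "nx ?p (s n) = ?x" using nx_long[OF b] b on_face_long by auto
    show ?case
    proof (cases "i = 0")
      case True
      then show ?thesis using step[OF X p(1)] p Xn by simp
    next
      case False
      \<comment> \<open>Strictly inside the long side there is no rung, so both neighbours on the
        line are forced into \<open>C\<close>.\<close>
      have "?x div K = n" using False Suc.prems by (intro div_eqI) auto
      then have "\<not> K dvd ?x" using Suc.prems dvd_mult_div_cancel[of K ?x] by auto
      then show ?thesis using core_neighbours[OF C IH p] by auto
    qed
  qed
  have "v \<in> C" if v: "v \<in> face_vs n" for v
  proof -
    obtain x y where xy: "v = vx x y" "on x y" "K * n \<le> x" "x \<le> K * n + K"
      using v by (auto simp: face_vs_def)
    show ?thesis
    proof (cases "y = s n")
      case True
      then show ?thesis using long[of "nat (K * n + K - x)"] xy by auto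
    next
      case False
      then have "x = K * n \<or> x = K * n + K" using on_face_short[of n x] xy by auto
      then show ?thesis using False short X xy Xn by auto
    qed
  qed
  then show ?thesis by blast
qed

lemma has_girth_G: "has_girth G r"
  unfolding has_girth_def
proof (intro conjI allI impI)
  show "\<exists>c. is_cycle G c \<and> length c = r"
    using is_cycle_face_list length_face_list by blast
  fix c assume "is_cycle G c"
  moreover obtain n where "face_vs n \<subseteq> set c"
    using core_contains_face[OF core_cycle[OF calculation]] by blast
  ultimately show "r \<le> length c"
    by (metis List.finite_set card_face_vs card_length card_mono order_trans)
qed

text \<open>A core contains a face, and equal cardinality makes them coincide. This describes the
  faces by notions that every graph isomorphism preserves.\<close>

lemma core_card_iff: "core G C \<and> card C = r \<longleftrightarrow> (\<exists>n. C = face_vs n)"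
proof
  assume C: "core G C \<and> card C = r"
  then obtain n where "face_vs n \<subseteq> C" using core_contains_face by blast
  moreover have "finite C" using C by (simp add: core_def)
  ultimately have "C = face_vs n" using C card_face_vs card_subset_eq by metis
  then show "\<exists>n. C = face_vs n" by blast
qed (use core_face_vs card_face_vs in auto)

section \<open>Intersections of faces and changes of the short side\<close>

lemma face_vs_Int_ne: "face_vs n \<inter> face_vs m \<noteq> {} \<longleftrightarrow> \<bar>n - m\<bar> \<le> 1"
proof
  assume "face_vs n \<inter> face_vs m \<noteq> {}"
  then obtain x where "K * n \<le> x" "x \<le> K * n + K" "K * m \<le> x" "x \<le> K * m + K"
    by (auto simp: face_vs_def)
  then have "K * n \<le> K * (m + 1)" "K * m \<le> K * (n + 1)" unfolding distrib_left by auto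
  then show "\<bar>n - m\<bar> \<le> 1" unfolding mult_K_le by linarith
next
  assume "\<bar>n - m\<bar> \<le> 1"
  then consider "n = m" | "n = m + 1" | "m = n + 1" by linarith
  then show "face_vs n \<inter> face_vs m \<noteq> {}"
  proof cases
    case 1
    have "vx (K * n) True \<in> face_vs n" using K_pos by (simp add: vx_in_face_vs)
    then show ?thesis using 1 by auto
  next
    case 2
    then have "vx (K * n) True \<in> face_vs n \<inter> face_vs m"
      using K_pos by (auto simp: vx_in_face_vs distrib_left)
    then show ?thesis by auto
  next
    case 3
    then have "vx (K * m) True \<in> face_vs n \<inter> face_vs m"
      using K_pos by (auto simp: vx_in_face_vs distrib_left)
    then show ?thesis by auto
  qed
qed

lemma face_vs_Int_Suc: "face_vs n \<inter> face_vs (n + 1) = {vx (K * n + K) y | y. True}"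
  using K_pos by (auto simp: face_vs_def distrib_left)

lemma face_vs_inj: "face_vs n = face_vs m \<longleftrightarrow> n = m"
proof
  assume eq: "face_vs n = face_vs m"
  have "vx (K * n) True \<in> face_vs n" "vx (K * m) True \<in> face_vs m"
    using K_pos by (simp_all add: vx_in_face_vs)
  then have "K * n \<le> K * m" "K * m \<le> K * n" using eq vx_in_face_vs by blast+
  then show "n = m" unfolding mult_K_le by simp
qed simp

text \<open>Two consecutive rungs are joined by one edge, on the short side of the face between them.
  So consecutive faces have their short sides on the same line iff these edges share a vertex.\<close>

definition straight :: "int \<Rightarrow> int \<Rightarrow> int \<Rightarrow> int \<Rightarrow> bool" where
  "straight i j k l \<longleftrightarrow> (\<exists>u\<in>face_vs i \<inter> face_vs j. \<exists>w\<in>face_vs j \<inter> face_vs k. \<exists>z\<in>face_vs k \<inter> face_vs l.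
     {u, w} \<in> edges G \<and> {w, z} \<in> edges G)"

text \<open>Needed for reflections, which reverse the order of the four faces.\<close>

lemma straight_sym: "straight i j k l \<longleftrightarrow> straight l k j i"
proof -
  have "straight l k j i" if straight: "straight i j k l" for i j k l
  proof -
    obtain u w z where "u \<in> face_vs i \<inter> face_vs j" "w \<in> face_vs j \<inter> face_vs k"
        "z \<in> face_vs k \<inter> face_vs l" "{u, w} \<in> edges G" "{w, z} \<in> edges G"
      using straight by (auto simp: straight_def)
    then show ?thesis
      unfolding straight_def
      by (intro bexI[of _ z] bexI[of _ w] bexI[of _ u]) (auto simp: insert_commute)
  qed
  then show ?thesis by blast
qed

text \<open>Here \<open>K \<ge> 2\<close> is essential: a long side is not a single edge, so the
  short side can be told apart in the graph.\<close>

lemma between_rungs: "{vx (K * n) y, vx (K * n + K) y'} \<in> edges G \<longleftrightarrow> y = y' \<and> y = (\<not> s n)"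
proof -
  have "nx (K * n + K) y \<noteq> K * n" using less_nx[of "K * n + K" y] K_pos by auto
  then show ?thesis using K_ge_2 by (auto simp: edges_vx nx_def)
qed

text \<open>The four faces serve to name three consecutive rungs as intersections; only the sides of
  the two middle faces are compared.\<close>

lemma straight_iff: "straight (n - 1) n (n + 1) (n + 2) \<longleftrightarrow> s n = s (n + 1)"
proof -
  have 1: "face_vs (n - 1) \<inter> face_vs n = {vx (K * n) y | y. True}"
    using face_vs_Int_Suc[of "n - 1"] by (simp add: algebra_simps)
  have 2: "face_vs n \<inter> face_vs (n + 1) = {vx (K * n + K) y | y. True}" by (rule face_vs_Int_Suc)
  have 3: "face_vs (n + 1) \<inter> face_vs (n + 2) = {vx (K * (n + 1) + K) y | y. True}"
    using face_vs_Int_Suc[of "n + 1"] by (simp add: algebra_simps)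
  have e: "{vx (K * n + K) y, vx (K * (n + 1) + K) y'} \<in> edges G \<longleftrightarrow> y = y' \<and> y = (\<not> s (n + 1))" for y y'
    using between_rungs[of "n + 1" y y'] by (simp add: distrib_left)
  have "straight (n - 1) n (n + 1) (n + 2) \<longleftrightarrow>
      (\<exists>y y' y''. {vx (K * n) y, vx (K * n + K) y'} \<in> edges G \<and>
         {vx (K * n + K) y', vx (K * (n + 1) + K) y''} \<in> edges G)"
    unfolding straight_def 1 2 3 by blast
  then show ?thesis unfolding between_rungs e by auto
qed


section \<open>The plane realization\<close>

lemma in_curve_nx:
  "z \<in> curve D {vx x y, vx (nx x y) y} \<longleftrightarrow>
     Im z = of_bool y \<and> of_int x \<le> Re z \<and> Re z \<le> of_int (nx x y)"
  using less_nx[of x y] by (intro in_curve_horizontal) simp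

lemma between_nx:
  assumes "on x y" "on t y" "x \<le> t" "t \<le> nx x y"
  shows "t = x \<or> t = nx x y"
  using nx_le_next[of x y t] assms by fastforce

lemma curve_inter_less:
  assumes "on x y" "on x' y" "x < x'"
    "z \<in> curve D {vx x y, vx (nx x y) y}" "z \<in> curve D {vx x' y, vx (nx x' y) y}"
  shows "nx x y = x' \<and> z = P (vx x' y)"
proof -
  have "nx x y \<le> x'" using assms nx_le_next by blast
  moreover have "of_int x' \<le> Re z" "Re z \<le> of_int (nx x y)" and im: "Im z = of_bool y"
    using assms unfolding in_curve_nx by auto
  ultimately have "nx x y = x'" "Re z = of_int x'" by linarith+
  then show ?thesis using im by (simp add: complex_eq_iff)
qed

lemma curve_inter_rung:
  assumes "on x y" "z \<in> curve D {vx x y, vx (nx x y) y}"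
    "z \<in> curve D {vx (K * n) False, vx (K * n) True}"
  shows "z \<in> P ` ({vx x y, vx (nx x y) y} \<inter> {vx (K * n) False, vx (K * n) True})"
proof -
  have z: "Im z = of_bool y" "of_int x \<le> Re z" "Re z \<le> of_int (nx x y)" "Re z = of_int (K * n)"
    using assms(2,3) unfolding in_curve_nx in_curve_rung by auto
  then have "x \<le> K * n" "K * n \<le> nx x y" by (simp_all only: of_int_le_iff)
  then have "K * n = x \<or> K * n = nx x y" using assms(1) by (intro between_nx) auto
  moreover have "z = P (vx (K * n) y)" using z by (simp add: complex_eq_iff)
  ultimately show ?thesis by (intro image_eqI[of _ _ "vx (K * n) y"]) auto
qed

lemma curve_inter:
  assumes "e \<in> edges G" "e' \<in> edges G" "e \<noteq> e'"
  shows "curve D e \<inter> curve D e' \<subseteq> P ` (e \<inter> e')"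
proof
  fix z assume "z \<in> curve D e \<inter> curve D e'"
  then have z: "z \<in> curve D e" "z \<in> curve D e'" by auto
  from assms(1) show "z \<in> P ` (e \<inter> e')"
  proof (cases rule: edge_cases)
    case e: (horizontal x y)
    from assms(2) show ?thesis
    proof (cases rule: edge_cases)
      case e': (horizontal x' y')
      have y: "y = y'" using z unfolding e e' in_curve_nx by (auto simp: of_bool_eq_iff)
      have "x \<noteq> x'" using e e' y assms(3) by auto
      then consider "x < x'" | "x' < x" by linarith
      then show ?thesis
      proof cases
        case 1
        then have "nx x y = x' \<and> z = P (vx x' y)" using curve_inter_less[of x y x' z] z e e' y by auto
        then show ?thesis using e e' y by (intro image_eqI[of _ _ "vx x' y"]) auto
      next
        case 2
        then have "nx x' y = x \<and> z = P (vx x y)" using curve_inter_less[of x' y x z] z e e' y by auto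
        then show ?thesis using e e' y by (intro image_eqI[of _ _ "vx x y"]) auto
      qed
    next
      case (rung n)
      then show ?thesis using curve_inter_rung z e by simp
    qed
  next
    case e: (rung n)
    from assms(2) show ?thesis
    proof (cases rule: edge_cases)
      case (horizontal x' y')
      then show ?thesis using curve_inter_rung[of x' y' z n] z e by (simp add: Int_commute)
    next
      case (rung m)
      then have "K * n = K * m" using z e unfolding in_curve_rung by (metis in_curve_rung of_int_eq_iff)
      then have "n = m" using K_pos by simp
      then show ?thesis using e rung assms(3) by blast
    qed
  qed
qed

lemma vertex_on_curve:
  assumes "e \<in> edges G" "v \<in> verts G" "P v \<in> curve D e"
  shows "v \<in> e"
proof -
  obtain x y where v: "v = vx x y" "on x y" using assms(2) by (auto simp: verts_G)
  from assms(1) show ?thesis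
  proof (cases rule: edge_cases)
    case (horizontal x' y')
    then have "y = y'" "x' \<le> x" "x \<le> nx x' y'"
      using assms(3) unfolding v horizontal in_curve_nx by (auto simp: of_bool_eq_iff)
    then show ?thesis using between_nx[of x' y' x] v horizontal by auto
  next
    case (rung n)
    then have "of_int x = (of_int (K * n) :: real)"
      using assms(3) unfolding v rung in_curve_rung P_vx complex.sel by blast
    then show ?thesis using v rung by (cases y) (simp_all only: of_int_eq_iff insert_iff simp_thms)
  qed
qed

lemma finite_vertices_in_bounded: "finite {v. \<exists>x y. v = vx x y \<and> \<bar>x\<bar> \<le> b}"
proof -
  have "{v. \<exists>x y. v = vx x y \<and> \<bar>x\<bar> \<le> b} \<subseteq> (\<lambda>(x, y). vx x y) ` ({-b..b} \<times> UNIV)" by force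
  then show ?thesis by (rule finite_subset) simp
qed

lemma locally_finite:
  assumes "compact C"
  shows "finite {v \<in> verts G. P v \<in> C}" "finite {e \<in> edges G. curve D e \<inter> C \<noteq> {}}"
proof -
  obtain b0 where b0: "\<And>z. z \<in> C \<Longrightarrow> norm z \<le> b0"
    using compact_imp_bounded[OF assms] by (auto simp: bounded_iff)
  obtain b :: int where "b0 \<le> of_int b" using ex_le_of_int by blast
  then have b: "\<bar>Re z\<bar> \<le> of_int b" if "z \<in> C" for z
    using b0[OF that] abs_Re_le_cmod[of z] by linarith
  \<comment> \<open>A horizontal edge has length at most \<open>K\<close>, so both ends of an edge
    that meets \<open>C\<close> stay within this margin.\<close>
  let ?V = "{v. \<exists>x y. v = vx x y \<and> \<bar>x\<bar> \<le> b + 2 * K}"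
  have "{v \<in> verts G. P v \<in> C} \<subseteq> ?V"
  proof
    fix v assume "v \<in> {v \<in> verts G. P v \<in> C}"
    then obtain x y where "v = vx x y" "P (vx x y) \<in> C" by (auto simp: verts_G)
    then show "v \<in> ?V" using b[of "P (vx x y)"] K_pos by auto
  qed
  then show "finite {v \<in> verts G. P v \<in> C}"
    using finite_vertices_in_bounded finite_subset by blast
  have "{e \<in> edges G. curve D e \<inter> C \<noteq> {}} \<subseteq> Pow ?V"
  proof
    fix e assume "e \<in> {e \<in> edges G. curve D e \<inter> C \<noteq> {}}"
    then obtain z where e: "e \<in> edges G" "z \<in> curve D e" "z \<in> C" by auto
    from e(1) show "e \<in> Pow ?V"
    proof (cases rule: edge_cases)
      case (horizontal x y)
      then have "of_int x \<le> Re z" "Re z \<le> of_int (nx x y)" using e(2) unfolding horizontal in_curve_nx by auto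
      then have "x \<le> b" "- b \<le> nx x y" using b[OF e(3)] by linarith+
      then have "\<bar>x\<bar> \<le> b + 2 * K" "\<bar>nx x y\<bar> \<le> b + 2 * K" using less_nx[of x y] nx_le[of x y] by linarith+
      then show ?thesis using horizontal by auto
    next
      case (rung n)
      then have "Re z = of_int (K * n)" using e(2) unfolding rung in_curve_rung by auto
      then have "\<bar>K * n\<bar> \<le> b + 2 * K" using b[OF e(3)] K_pos by linarith
      then show ?thesis using rung by auto
    qed
  qed
  then show "finite {e \<in> edges G. curve D e \<inter> C \<noteq> {}}"
    using finite_vertices_in_bounded finite_subset by blast
qed

lemma inj_P: "inj_on P (verts G)"
  by (auto simp: inj_on_def verts_G of_bool_eq_iff)

lemma plane_realization_G: "plane_realization G D"
  unfolding plane_realization_def pt_D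
proof (intro conjI ballI allI impI)
  fix e assume e: "e \<in> edges G"
  then obtain u v where uv: "e = {u, v}" "u \<in> verts G" "v \<in> verts G" "u \<noteq> v"
    using simple_graph_G unfolding simple_graph_def by (metis card_2_iff insert_subset)
  then have "P u \<noteq> P v" using inj_P by (auto simp: inj_on_def)
  then show "\<exists>g. arc g \<and> path_image g = curve D e \<and> {pathstart g, pathfinish g} = P ` e"
    using uv by (intro exI[of _ "linepath (P u) (P v)"]) (simp add: curve_D)
qed (use inj_P vertex_on_curve curve_inter locally_finite in auto)

text \<open>The edges leave no gap on a line: start at the floor of \<open>t\<close> over a long
  side, and at the preceding rung over a short one.\<close>

lemma cover_line:
  obtains x where "on x y" "of_int x \<le> t" "t \<le> (of_int (nx x y) :: real)"
proof -
  let ?n = "\<lfloor>t\<rfloor>"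
  have t: "of_int ?n \<le> t" "t \<le> of_int (?n + 1)" by linarith+
  show ?thesis
  proof (cases "s (?n div K) = y")
    case True
    then have "on ?n y" "nx ?n y = ?n + 1" by (auto simp: on_def nx_def)
    then show ?thesis using that[of ?n] t by auto
  next
    case False
    let ?x = "K * (?n div K)"
    have "on ?x y" "nx ?x y = ?x + K" using False by (simp_all add: nx_def)
    moreover have "?x \<le> ?n" "?n + 1 \<le> ?x + K" using div_bounds[of ?n] by auto
    ultimately show ?thesis using that[of ?x] t by (smt (verit, best) of_int_le_iff)
  qed
qed

text \<open>As a point set the skeleton does not depend on \<open>s\<close>.\<close>

lemma skeleton_G:
  "z \<in> skeleton G D \<longleftrightarrow> Im z = 0 \<or> Im z = 1 \<or> 0 \<le> Im z \<and> Im z \<le> 1 \<and> (\<exists>n. Re z = of_int (K * n))"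
  (is "?L \<longleftrightarrow> ?R")
proof
  have "?R" if "z \<in> curve D e" "e \<in> edges G" for e
    using that(2)
  proof (cases rule: edge_cases)
    case (horizontal x y)
    then show ?thesis using that(1) unfolding horizontal in_curve_nx by (cases y) auto
  next
    case (rung n)
    then show ?thesis using that(1) unfolding rung in_curve_rung by blast
  qed
  moreover have "?R" if "z \<in> P ` verts G" using that by (auto simp: verts_G)
  ultimately show "?L \<Longrightarrow> ?R" by (auto simp: skeleton_def)
next
  have line: ?L if "Im z = of_bool y" for y
  proof -
    obtain x where x: "on x y" "of_int x \<le> Re z" "Re z \<le> of_int (nx x y)" using cover_line by blast
    then have "z \<in> curve D {vx x y, vx (nx x y) y}" using that by (simp add: in_curve_nx)
    then show ?thesis using x by (auto simp: skeleton_def)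
  qed
  assume ?R
  then consider "Im z = 0" | "Im z = 1" | n where "0 \<le> Im z" "Im z \<le> 1" "Re z = of_int (K * n)" by blast
  then show ?L
  proof cases
    case 1 then show ?thesis using line[of False] by simp
  next
    case 2 then show ?thesis using line[of True] by simp
  next
    case (3 n)
    then have "z \<in> curve D {vx (K * n) False, vx (K * n) True}" unfolding in_curve_rung by blast
    then show ?thesis by (auto simp: skeleton_def)
  qed
qed

section \<open>The interior faces\<close>

definition cell :: "int \<Rightarrow> complex set" where
  "cell n = box (Complex (of_int (K * n)) 0) (Complex (of_int (K * n + K)) 1)"

lemma in_cell: "z \<in> cell n \<longleftrightarrow> of_int (K * n) < Re z \<and> Re z < of_int (K * n + K) \<and> 0 < Im z \<and> Im z < 1"
  unfolding cell_def in_box_complex_iff by auto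

lemma cell_ne: "cell n \<noteq> {}"
proof -
  have "Complex (of_int (K * n) + 1) (1 / 2) \<in> cell n"
    using K_ge_2 unfolding in_cell by simp
  then show ?thesis by blast
qed

lemma closure_cell: "z \<in> closure (cell n) \<longleftrightarrow>
    of_int (K * n) \<le> Re z \<and> Re z \<le> of_int (K * n + K) \<and> 0 \<le> Im z \<and> Im z \<le> 1"
proof -
  have "closure (cell n) = cbox (Complex (of_int (K * n)) 0) (Complex (of_int (K * n + K)) 1)"
    using cell_ne[of n] unfolding cell_def by (rule closure_box)
  then show ?thesis by (simp only: in_cbox_complex_iff complex.sel) auto
qed

lemma frontier_cell: "z \<in> frontier (cell n) \<longleftrightarrow>
    of_int (K * n) \<le> Re z \<and> Re z \<le> of_int (K * n + K) \<and> 0 \<le> Im z \<and> Im z \<le> 1 \<and>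
    (Re z = of_int (K * n) \<or> Re z = of_int (K * n + K) \<or> Im z = 0 \<or> Im z = 1)"
proof -
  have "interior (cell n) = cell n" unfolding cell_def by (simp add: interior_open open_box)
  then show ?thesis by (simp only: frontier_def Diff_iff closure_cell in_cell) auto
qed

lemma skeleton_Int_cell: "cell n \<inter> skeleton G D = {}"
proof -
  have False if z: "z \<in> cell n" "z \<in> skeleton G D" for z
  proof -
    obtain m where m: "Re z = of_int (K * m)" using z unfolding in_cell skeleton_G by auto
    then have "K * n < K * m" "K * m < K * n + K" using z(1) unfolding in_cell by (simp_all only: of_int_less_iff)
    then have "K * n < K * m" "K * m < K * (n + 1)" by (simp_all add: distrib_left)
    then show False using K_pos by simp
  qed
  then show ?thesis by blast
qed

text \<open>A connected set that meets a cell and leaves it must meet the frontier, which belongs to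
  the skeleton.\<close>

lemma cell_component: "cell n \<in> components (- skeleton G D)"
  unfolding in_components_maximal
proof (intro conjI allI impI)
  show "cell n \<noteq> {}" by (rule cell_ne)
  show "cell n \<subseteq> - skeleton G D" using skeleton_Int_cell by blast
  show "connected (cell n)" unfolding cell_def by (intro convex_connected convex_box)
  fix S assume S: "S \<noteq> {} \<and> cell n \<subseteq> S \<and> S \<subseteq> - skeleton G D \<and> connected S"
  have "frontier (cell n) \<subseteq> skeleton G D"
  proof
    fix z assume "z \<in> frontier (cell n)"
    moreover have "K * n + K = K * (n + 1)" by (simp add: distrib_left)
    ultimately show "z \<in> skeleton G D" unfolding frontier_cell skeleton_G by metis
  qed
  then have "S \<inter> frontier (cell n) = {}" using S by blast
  then have "S \<inter> cell n = {} \<or> S - cell n = {}" using S connected_Int_frontier by blast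
  then show "S = cell n" using S cell_ne by blast
qed

text \<open>A bounded component cannot meet the half-planes beside the strip, since it would contain
  them entirely. Its points therefore lie strictly between the lines and off the rungs, which puts
  them into cells.\<close>

lemma interior_faces_G: "interior_faces G D = range cell"
proof
  show "range cell \<subseteq> interior_faces G D"
    using cell_component by (auto simp: interior_faces_def cell_def)
  show "interior_faces G D \<subseteq> range cell"
  proof
    fix F assume "F \<in> interior_faces G D"
    then have F: "F \<in> components (- skeleton G D)" "bounded F" by (auto simp: interior_faces_def)
    then obtain z where z: "z \<in> F" "z \<notin> skeleton G D"
      using in_components_nonempty in_components_subset by blast
    have no: False if "convex T" "T \<subseteq> - skeleton G D" "z \<in> T" "\<not> bounded T" for T
      using components_maximal[OF F(1) convex_connected[OF that(1)] that(2)] z(1) that F(2) bounded_subset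
      by blast
    have "{z. Im z > 1} \<subseteq> - skeleton G D" "{z. Im z < 0} \<subseteq> - skeleton G D"
      by (auto simp: skeleton_G)
    then have "\<not> Im z > 1" "\<not> Im z < 0"
      using no[OF convex_halfspace_Im_gt] no[OF convex_halfspace_Im_lt] unbounded_halfplanes by auto
    moreover have nn: "Im z \<noteq> 0" "Im z \<noteq> 1" "0 \<le> Im z \<Longrightarrow> Im z \<le> 1 \<Longrightarrow> Re z \<noteq> of_int (K * n)" for n
      using z(2) unfolding skeleton_G by blast+
    ultimately have im: "0 < Im z" "Im z < 1" by linarith+
    define n where "n = \<lfloor>Re z / of_int K\<rfloor>"
    have "of_int n \<le> Re z / of_int K" "Re z / of_int K < of_int n + 1" unfolding n_def by linarith+
    then have "of_int (K * n) \<le> Re z" "Re z < of_int (K * n + K)"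
      using K_pos by (simp_all add: field_simps)
    then have "z \<in> cell n" unfolding in_cell using im nn(3)[of n] by auto
    then have "F = cell n" using components_eq[OF F(1) cell_component] z(1) by blast
    then show "F \<in> range cell" by blast
  qed
qed

lemma P_in_frontier: "v \<in> verts G \<Longrightarrow> P v \<in> frontier (cell n) \<longleftrightarrow> v \<in> face_vs n"
proof -
  assume "v \<in> verts G"
  then obtain x y where v: "v = vx x y" "on x y" by (auto simp: verts_G)
  show ?thesis unfolding v frontier_cell vx_in_face_vs P_vx complex.sel of_int_le_iff using v(2) by (cases y) auto
qed

lemma curve_in_frontier:
  assumes "e \<in> edges G"
  shows "curve D e \<subseteq> frontier (cell n) \<longleftrightarrow> e \<subseteq> face_vs n"
proof
  assume "curve D e \<subseteq> frontier (cell n)"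
  moreover have "e \<subseteq> verts G" using assms simple_graph_G by (auto simp: simple_graph_def)
  ultimately show "e \<subseteq> face_vs n" using P_in_curve P_in_frontier by blast
next
  assume sub: "e \<subseteq> face_vs n"
  show "curve D e \<subseteq> frontier (cell n)"
  proof
    fix z assume z: "z \<in> curve D e"
    from assms show "z \<in> frontier (cell n)"
    proof (cases rule: edge_cases)
      case (horizontal x y)
      then have "K * n \<le> x" "nx x y \<le> K * n + K" using sub by (auto simp: vx_in_face_vs)
      then have "of_int (K * n) \<le> (of_int x :: real)" "(of_int (nx x y) :: real) \<le> of_int (K * n + K)"
        by (simp_all only: of_int_le_iff)
      then show ?thesis using z unfolding horizontal in_curve_nx frontier_cell by (cases y) auto
    next
      case (rung m)
      then have "vx (K * m) True \<in> face_vs n" "vx (K * m) False \<in> face_vs n" using sub by auto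
      then have "K * n \<le> K * m" "K * m \<le> K * n + K" by (auto simp: vx_in_face_vs)
      moreover from this have "K * n \<le> K * m" "K * m \<le> K * (n + 1)" by (simp_all add: distrib_left)
      then have "m = n \<or> m = n + 1" unfolding mult_K_le by linarith
      then have "K * m = K * n \<or> K * m = K * n + K" by (auto simp: distrib_left)
      ultimately show ?thesis using z unfolding rung in_curve_rung frontier_cell by (metis of_int_le_iff)
    qed
  qed
qed

lemma face_verts_cell: "face_verts G D (cell n) = face_vs n"
  using P_in_frontier face_vs_subset by (auto simp: face_verts_def)

lemma face_edges_cell: "face_edges G D (cell n) = pos_edges (pos n)"
  using curve_in_frontier by (auto simp: face_edges_def pos_edges_pos)

lemma frontier_cell_curves: "frontier (cell n) = (\<Union>e\<in>pos_edges (pos n). curve D e)"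
proof
  show "(\<Union>e\<in>pos_edges (pos n). curve D e) \<subseteq> frontier (cell n)"
    using curve_in_frontier unfolding pos_edges_pos by blast
  show "frontier (cell n) \<subseteq> (\<Union>e\<in>pos_edges (pos n). curve D e)"
  proof
    fix z assume "z \<in> frontier (cell n)"
    then have z: "of_int (K * n) \<le> Re z" "Re z \<le> of_int (K * n + K)" "0 \<le> Im z" "Im z \<le> 1"
        "Re z = of_int (K * n) \<or> Re z = of_int (K * n + K) \<or> Im z = 0 \<or> Im z = 1"
      unfolding frontier_cell by blast+
    have "\<exists>e\<in>edges G. e \<subseteq> face_vs n \<and> z \<in> curve D e"
    proof (cases "Re z = of_int (K * n) \<or> Re z = of_int (K * n + K)")
      case True
      then obtain m where m: "m = n \<or> m = n + 1" "Re z = of_int (K * m)"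
        by (metis mult.right_neutral distrib_left)
      then have "z \<in> curve D {vx (K * m) False, vx (K * m) True}" unfolding in_curve_rung using z by blast
      moreover have "{vx (K * m) False, vx (K * m) True} \<subseteq> face_vs n"
        using m K_pos by (auto simp: vx_in_face_vs distrib_left)
      ultimately show ?thesis using rung_edge by blast
    next
      case False
      then obtain y where y: "Im z = of_bool y" using z(5) by (metis of_bool_eq)
      obtain x where x: "on x y" "of_int x \<le> Re z" "Re z \<le> of_int (nx x y)" using cover_line by blast
      have "of_int (K * n) < Re z" "Re z < of_int (K * n + K)" using z False by linarith+
      then have "K * n < nx x y" "x < K * n + K" using x by linarith+
      \<comment> \<open>The covering edge cannot stick out of the cell, because the corners are
        vertices and \<open>nx\<close> skips no vertex.\<close>
      moreover have "K * n \<le> x" using calculation nx_le_next[OF x(1) on_mult[of n]] by linarith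
      moreover have "nx x y \<le> K * n + K" using calculation nx_le_next[OF x(1) on_mult_add[of n]] by linarith
      ultimately have "{vx x y, vx (nx x y) y} \<subseteq> face_vs n"
        using x(1) on_nx by (simp add: vx_in_face_vs)
      moreover have "z \<in> curve D {vx x y, vx (nx x y) y}" using x y unfolding in_curve_nx by blast
      ultimately show ?thesis using x(1) by blast
    qed
    then show "z \<in> (\<Union>e\<in>pos_edges (pos n). curve D e)" unfolding pos_edges_pos by blast
  qed
qed

lemma combinatorial_gon_cell: "combinatorial_gon r G D (cell n)"
  unfolding combinatorial_gon_def
  using is_cycle_face_list[of n] length_face_list[of n]
  by (metis cycle_edges_face_list frontier_cell_curves)

text \<open>The filled polycycle lies in the closed strip, so its interior lies in the open strip,
  which contains no vertex.\<close>

lemma interior_verts_G: "interior_verts G D = {}"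
proof -
  let ?S = "skeleton G D \<union> \<Union>(interior_faces G D)"
  have sub: "?S \<subseteq> {z. 0 \<le> Im z \<and> Im z \<le> 1}"
    unfolding interior_faces_G by (auto simp: skeleton_G in_cell)
  have int: "interior ?S \<subseteq> {z. 0 < Im z \<and> Im z < 1}"
  proof -
    have "interior ?S \<subseteq> interior {z. 0 \<le> Im z} \<inter> interior {z. Im z \<le> 1}"
      using sub by (intro Int_greatest interior_mono) auto
    moreover have "interior {z. 0 \<le> Im z} = {z. 0 < Im z}" "interior {z. Im z \<le> 1} = {z. Im z < 1}"
      using interior_halfspace_ge[of \<i> 0] interior_halfspace_le[of \<i> 1] by simp_all
    ultimately show ?thesis by auto
  qed
  have "P v \<in> frontier ?S" if v: "v \<in> verts G" for v
  proof -
    have "P v \<in> skeleton G D" using v by (auto simp: skeleton_def)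
    then have "P v \<in> closure ?S" using closure_subset by blast
    moreover have "P v \<notin> interior ?S" using v int by (auto simp: verts_G)
    ultimately show ?thesis by (simp add: frontier_def)
  qed
  then show ?thesis by (auto simp: interior_verts_def realization_boundary_def)
qed

lemma closure_cell_disjoint: "closure (cell n) \<inter> closure (cell m) \<noteq> {} \<longleftrightarrow> \<bar>n - m\<bar> \<le> 1"
proof
  assume "closure (cell n) \<inter> closure (cell m) \<noteq> {}"
  then obtain z where z: "z \<in> closure (cell n)" "z \<in> closure (cell m)" by blast
  then have "K * n \<le> K * m + K" "K * m \<le> K * n + K" unfolding closure_cell by linarith+
  then have "K * n \<le> K * (m + 1)" "K * m \<le> K * (n + 1)" unfolding distrib_left by auto
  then show "\<bar>n - m\<bar> \<le> 1" unfolding mult_K_le by linarith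
next
  assume "\<bar>n - m\<bar> \<le> 1"
  then obtain v where "v \<in> face_vs n" "v \<in> face_vs m" using face_vs_Int_ne by blast
  then have "P v \<in> frontier (cell n)" "P v \<in> frontier (cell m)"
    using P_in_frontier face_vs_subset by blast+
  then show "closure (cell n) \<inter> closure (cell m) \<noteq> {}" by (auto simp: frontier_def)
qed

lemma closure_cell_Suc:
  "closure (cell n) \<inter> closure (cell (n + 1)) = curve D {vx (K * (n + 1)) False, vx (K * (n + 1)) True}"
  unfolding set_eq_iff Int_iff closure_cell in_curve_rung using K_pos by (auto simp: distrib_left)

lemma polycyclic_realization_G: "polycyclic_realization r q G D"
  unfolding polycyclic_realization_def interior_faces_G interior_verts_G
proof (intro conjI)
  have adj: "\<exists>e\<in>edges G. closure (cell n) \<inter> closure (cell (n + 1)) = curve D e" for n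
    unfolding closure_cell_Suc by blast
  show "\<forall>F\<in>range cell. \<forall>F'\<in>range cell. F \<noteq> F' \<longrightarrow>
     (\<exists>e\<in>edges G. closure F \<inter> closure F' = curve D e) \<or>
     (\<exists>v\<in>verts G. closure F \<inter> closure F' = {pt D v}) \<or> closure F \<inter> closure F' = {}"
  proof (intro ballI impI)
    fix F F' assume "F \<in> range cell" "F' \<in> range cell" and ne: "F \<noteq> F'"
    then obtain n m where nm: "F = cell n" "F' = cell m" by blast
    then have "n \<noteq> m" using ne by auto
    then consider "m = n + 1" | "n = m + 1" | "\<not> \<bar>n - m\<bar> \<le> 1" by linarith
    then show "(\<exists>e\<in>edges G. closure F \<inter> closure F' = curve D e) \<or>
     (\<exists>v\<in>verts G. closure F \<inter> closure F' = {pt D v}) \<or> closure F \<inter> closure F' = {}"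
    proof cases
      case 1 then show ?thesis using adj[of n] nm by blast
    next
      case 2 then show ?thesis using adj[of m] nm by (metis Int_commute)
    next
      case 3 then show ?thesis using closure_cell_disjoint[of n m] nm by blast
    qed
  qed
qed (use plane_realization_G combinatorial_gon_cell in auto)

lemma polycycle_G: "polycycle r 3 G"
  unfolding polycycle_def
  using simple_graph_G two_connected_G has_girth_G max_degree_G polycyclic_realization_G by blast

lemma corona_cell: "corona G D (cell n) = {cell (n - 1), cell n, cell (n + 1)}"
proof -
  have "corona G D (cell n) = cell ` {m. \<bar>n - m\<bar> \<le> 1}"
    unfolding corona_def interior_faces_G using closure_cell_disjoint by auto
  also have "{m. \<bar>n - m\<bar> \<le> 1} = {n - 1, n, n + 1}" by auto
  finally show ?thesis by simp
qed


section \<open>Coronas\<close>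

lemma pos_edges_cong: "(\<And>i. i < r \<Longrightarrow> f i = g i) \<Longrightarrow> pos_edges f = pos_edges g"
  unfolding pos_edges_def setcompr_eq_image using r_ge_5 by (intro image_cong) auto

lemma pos_edges_image: "(`) \<phi> ` pos_edges f = pos_edges (\<phi> \<circ> f)"
  unfolding pos_edges_def setcompr_eq_image by (auto simp: image_image)

lemma Union_pos_edges: "\<Union>(pos_edges f) = f ` {..<r}"
proof
  show "\<Union>(pos_edges f) \<subseteq> f ` {..<r}" using r_ge_5 by (auto simp: pos_edges_def)
  show "f ` {..<r} \<subseteq> \<Union>(pos_edges f)" unfolding pos_edges_def by blast
qed

text \<open>\<open>h\<close> commutes with the cyclic successor, so it only permutes the edges of
  the cycle.\<close>

lemma pos_edges_rotate:
  assumes "h ` {..<r} = {..<r}" "\<And>i. i < r \<Longrightarrow> h (Suc i mod r) = Suc (h i) mod r"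
  shows "pos_edges (f \<circ> h) = pos_edges f"
proof -
  have "pos_edges (f \<circ> h) = (\<lambda>i. {f (h i), f (Suc (h i) mod r)}) ` {..<r}"
    unfolding pos_edges_def setcompr_eq_image using assms(2) by (intro image_cong) auto
  also have "\<dots> = (\<lambda>i. {f i, f (Suc i mod r)}) ` h ` {..<r}" by (simp add: image_image)
  also have "\<dots> = pos_edges f" unfolding assms(1) by (auto simp: pos_edges_def)
  finally show ?thesis .
qed

lemma Suc_mod_image: "(\<lambda>i. Suc i mod r) ` {..<r} = {..<r}"
proof -
  have "k \<in> (\<lambda>i. Suc i mod r) ` {..<r}" if "k < r" for k
    using that by (intro image_eqI[of _ _ "if k = 0 then r - 1 else k - 1"]) auto
  then show ?thesis using r_ge_5 by auto
qed

text \<open>\<open>h\<close> reverses the cyclic order: the edge from \<open>i\<close> to its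
  successor becomes the edge that starts at \<open>h\<close> of the successor of
  \<open>i\<close>.\<close>

lemma pos_edges_reflect:
  assumes "h ` {..<r} = {..<r}" "\<And>i. i < r \<Longrightarrow> Suc (h (Suc i mod r)) mod r = h i"
  shows "pos_edges (f \<circ> h) = pos_edges f"
proof -
  have "pos_edges (f \<circ> h) = (\<lambda>i. {f i, f (Suc i mod r)}) ` h ` (\<lambda>i. Suc i mod r) ` {..<r}"
    unfolding pos_edges_def setcompr_eq_image image_image using assms(2)
    by (intro image_cong) (auto simp: insert_commute)
  also have "\<dots> = pos_edges f" unfolding Suc_mod_image assms(1) by (auto simp: pos_edges_def)
  finally show ?thesis .
qed

text \<open>The three faces of the corona of cell \<open>m\<close> are traversed so that the traversals of the
  left and of the right neighbour run from vertex \<open>0\<close> to vertex \<open>r - 1\<close>, and from vertex \<open>r - 3\<close>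
  to vertex \<open>r - 2\<close>, of the central face. With this labelling the incidences no longer depend on
  \<open>m\<close> or \<open>s\<close>.\<close>

definition left_index :: "bool \<Rightarrow> nat \<Rightarrow> nat" where
  "left_index same i = (if same then (if i \<le> r - 3 then r - 3 - i else 2 * r - 3 - i)
                        else (if i < 2 then i + r - 2 else i - 2))"

definition right_index :: "bool \<Rightarrow> nat \<Rightarrow> nat" where
  "right_index same i = (if same then i else r - 1 - i)"

definition left_pos :: "int \<Rightarrow> nat \<Rightarrow> nat" where
  "left_pos m = pos (m - 1) \<circ> left_index (s (m - 1) = s m)"

definition right_pos :: "int \<Rightarrow> nat \<Rightarrow> nat" where
  "right_pos m = pos (m + 1) \<circ> right_index (s (m + 1) = s m)"

lemma left_index_image: "left_index b ` {..<r} = {..<r}"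
proof
  show "left_index b ` {..<r} \<subseteq> {..<r}" using r_ge_5 by (auto simp: left_index_def)
  show "{..<r} \<subseteq> left_index b ` {..<r}"
  proof
    fix k assume k: "k \<in> {..<r}"
    show "k \<in> left_index b ` {..<r}"
    proof (cases b)
      case True
      then show ?thesis using k r_ge_5
        by (intro image_eqI[of _ _ "if k \<le> r - 3 then r - 3 - k else 2 * r - 3 - k"])
           (auto simp: left_index_def)
    next
      case False
      then show ?thesis using k r_ge_5
        by (intro image_eqI[of _ _ "if k < r - 2 then k + 2 else k + 2 - r"])
           (auto simp: left_index_def)
    qed
  qed
qed

lemma right_index_image: "right_index b ` {..<r} = {..<r}"
proof
  show "right_index b ` {..<r} \<subseteq> {..<r}" using r_ge_5 by (auto simp: right_index_def)
  show "{..<r} \<subseteq> right_index b ` {..<r}"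
  proof
    fix k assume "k \<in> {..<r}"
    then show "k \<in> right_index b ` {..<r}"
      by (intro image_eqI[of _ _ "if b then k else r - 1 - k"]) (auto simp: right_index_def)
  qed
qed

lemma surj_imp_inj: "h ` {..<r} = {..<r} \<Longrightarrow> inj_on h {..<r}" for h :: "nat \<Rightarrow> nat"
  by (simp add: eq_card_imp_inj_on)

lemma Suc_mod: "i < r \<Longrightarrow> Suc i mod r = (if Suc i = r then 0 else Suc i)"
  by auto

lemma left_index_less: "i < r \<Longrightarrow> left_index b i < r"
  using left_index_image by blast

lemma right_index_less: "i < r \<Longrightarrow> right_index b i < r"
  using right_index_image by blast

text \<open>Modulo \<open>r\<close> the index is \<open>r - 3 - i\<close> if the long sides agree
  and \<open>i - 2\<close> otherwise, that is, a reflection or a rotation.\<close>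

lemma pos_edges_left_index: "pos_edges (f \<circ> left_index b) = pos_edges f"
proof (cases b)
  case True
  show ?thesis
  proof (rule pos_edges_reflect[OF left_index_image])
    fix i assume i: "i < r"
    \<comment> \<open>The successor modulo \<open>r\<close> is written as a case distinction, which
      leaves linear arithmetic.\<close>
    define j where "j = (if Suc i = r then 0 else Suc i)"
    have j: "j < r" using i by (auto simp: j_def)
    have "(if Suc (left_index b j) = r then 0 else Suc (left_index b j)) = left_index b i"
      using True i r_ge_5 unfolding left_index_def j_def by (auto split: if_splits)
    then show "Suc (left_index b (Suc i mod r)) mod r = left_index b i"
      unfolding Suc_mod[OF i] j_def[symmetric] Suc_mod[OF left_index_less[OF j]] .
  qed
next
  case False
  show ?thesis
  proof (rule pos_edges_rotate[OF left_index_image])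
    fix i assume i: "i < r"
    have "left_index b (if Suc i = r then 0 else Suc i) =
        (if Suc (left_index b i) = r then 0 else Suc (left_index b i))"
      using False i r_ge_5 unfolding left_index_def by (auto split: if_splits)
    then show "left_index b (Suc i mod r) = Suc (left_index b i) mod r"
      unfolding Suc_mod[OF i] Suc_mod[OF left_index_less[OF i]] .
  qed
qed

text \<open>The identity if the long sides agree, and the reflection \<open>r - 1 - i\<close>
  otherwise.\<close>

lemma pos_edges_right_index: "pos_edges (f \<circ> right_index b) = pos_edges f"
proof (cases b)
  case True
  then have "right_index b = id" by (auto simp: right_index_def)
  then show ?thesis by simp
next
  case False
  show ?thesis
  proof (rule pos_edges_reflect[OF right_index_image])
    fix i assume i: "i < r"
    define j where "j = (if Suc i = r then 0 else Suc i)"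
    have j: "j < r" using i by (auto simp: j_def)
    have "(if Suc (right_index b j) = r then 0 else Suc (right_index b j)) = right_index b i"
      using False i r_ge_5 unfolding right_index_def j_def by (auto split: if_splits)
    then show "Suc (right_index b (Suc i mod r)) mod r = right_index b i"
      unfolding Suc_mod[OF i] j_def[symmetric] Suc_mod[OF right_index_less[OF j]] .
  qed
qed

lemma left_pos_image: "left_pos m ` {..<r} = face_vs (m - 1)"
  unfolding left_pos_def image_comp[symmetric] left_index_image pos_image ..

lemma right_pos_image: "right_pos m ` {..<r} = face_vs (m + 1)"
  unfolding right_pos_def image_comp[symmetric] right_index_image pos_image ..

lemma inj_left_pos: "inj_on (left_pos m) {..<r}"
  unfolding left_pos_def
  by (intro comp_inj_on surj_imp_inj left_index_image) (simp add: left_index_image inj_pos)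

lemma inj_right_pos: "inj_on (right_pos m) {..<r}"
  unfolding right_pos_def
  by (intro comp_inj_on surj_imp_inj right_index_image) (simp add: right_index_image inj_pos)

lemma pos_in_next:
  assumes "i < r"
  shows "pos n i \<in> face_vs (n + 1) \<longleftrightarrow> i = r - 3 \<or> i = r - 2"
proof -
  have "i = r - 3 \<longleftrightarrow> int i = K" "i = r - 2 \<longleftrightarrow> int i = K + 1"
    using int_r r_ge_5 by linarith+
  moreover have "K * (n + 1) = K * n + K" by (simp add: distrib_left)
  ultimately show ?thesis
    using K_pos by (auto simp: pos_def vx_in_face_vs on_face_long)
qed

lemma pos_in_prev:
  assumes "i < r"
  shows "pos n i \<in> face_vs (n - 1) \<longleftrightarrow> i = 0 \<or> i = r - 1"
proof -
  have "i = r - 1 \<longleftrightarrow> int i = K + 2" "int i \<le> K \<or> int i = K + 1 \<or> int i = K + 2"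
    using int_r r_ge_5 assms by linarith+
  moreover have "K * (n - 1) = K * n - K" by (simp add: right_diff_distrib)
  ultimately show ?thesis
    using K_pos by (auto simp: pos_def vx_in_face_vs on_face_long)
qed

lemma left_pos_in:
  assumes "i < r"
  shows "left_pos m i \<in> face_vs m \<longleftrightarrow> i = 0 \<or> i = r - 1"
proof -
  have "left_pos m i \<in> face_vs m \<longleftrightarrow>
      left_index (s (m - 1) = s m) i = r - 3 \<or> left_index (s (m - 1) = s m) i = r - 2"
    using pos_in_next[OF left_index_less[OF assms], where n = "m - 1"] by (simp add: left_pos_def)
  also have "\<dots> \<longleftrightarrow> i = 0 \<or> i = r - 1" using assms r_ge_5 by (auto simp: left_index_def)
  finally show ?thesis .
qed

lemma right_pos_in:
  assumes "i < r"
  shows "right_pos m i \<in> face_vs m \<longleftrightarrow> i = 0 \<or> i = r - 1"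
proof -
  have "right_pos m i \<in> face_vs m \<longleftrightarrow>
      right_index (s (m + 1) = s m) i = 0 \<or> right_index (s (m + 1) = s m) i = r - 1"
    using pos_in_prev[OF right_index_less[OF assms], where n = "m + 1"] by (simp add: right_pos_def)
  also have "\<dots> \<longleftrightarrow> i = 0 \<or> i = r - 1" using assms r_ge_5 by (auto simp: right_index_def)
  finally show ?thesis .
qed

text \<open>This is what \<open>left_index\<close> is made for: index \<open>0\<close> goes to
  whichever end of the common rung lies on the long side of cell \<open>m\<close>.\<close>

lemma left_pos_ends: "left_pos m 0 = pos m 0" "left_pos m (r - 1) = pos m (r - 1)"
proof -
  have "K * (m - 1) + K = K * m" by (simp add: right_diff_distrib)
  moreover have "int (r - 3) = K" "int (r - 2) = K + 1" "int (r - 1) = K + 2"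
    "left_index b 0 = (if b then r - 3 else r - 2)" "left_index b (r - 1) = (if b then r - 2 else r - 3)" for b
    using int_r r_ge_5 by (auto simp: left_index_def)
  ultimately show "left_pos m 0 = pos m 0" "left_pos m (r - 1) = pos m (r - 1)"
    using K_pos by (auto simp: left_pos_def pos_def)
qed

lemma right_pos_ends: "right_pos m 0 = pos m (r - 3)" "right_pos m (r - 1) = pos m (r - 2)"
proof -
  have "K * (m + 1) = K * m + K" by (simp add: distrib_left)
  moreover have "int (r - 3) = K" "int (r - 2) = K + 1" "int (r - 1) = K + 2"
    "right_index b 0 = (if b then 0 else r - 1)" "right_index b (r - 1) = (if b then r - 1 else 0)" for b
    using int_r r_ge_5 by (auto simp: right_index_def)
  ultimately show "right_pos m 0 = pos m (r - 3)" "right_pos m (r - 1) = pos m (r - 2)"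
    using K_pos by (auto simp: right_pos_def pos_def)
qed

lemma pos_eq_iff: "i < r \<Longrightarrow> j < r \<Longrightarrow> pos m i = pos m j \<longleftrightarrow> i = j"
  using inj_pos by (auto simp: inj_on_def)

lemma pos_mem: "i < r \<Longrightarrow> pos m i \<in> face_vs m"
  using pos_image by blast

lemma left_pos_eq_pos:
  assumes "i < r" "j < r"
  shows "left_pos m i = pos m j \<longleftrightarrow> i = 0 \<and> j = 0 \<or> i = r - 1 \<and> j = r - 1"
proof -
  have "left_pos m i = pos m j \<Longrightarrow> i = 0 \<or> i = r - 1"
    using assms left_pos_in pos_mem by metis
  moreover have "left_pos m 0 = pos m j \<longleftrightarrow> j = 0" "left_pos m (r - 1) = pos m j \<longleftrightarrow> j = r - 1"
  proof -
    have "0 < r" "r - 1 < r" using r_ge_5 by auto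
    then show "left_pos m 0 = pos m j \<longleftrightarrow> j = 0" "left_pos m (r - 1) = pos m j \<longleftrightarrow> j = r - 1"
      unfolding left_pos_ends using assms pos_eq_iff by metis+
  qed
  moreover have "0 \<noteq> r - 1" using r_ge_5 by simp
  ultimately show ?thesis by metis
qed

lemma right_pos_eq_pos:
  assumes "i < r" "j < r"
  shows "right_pos m i = pos m j \<longleftrightarrow> i = 0 \<and> j = r - 3 \<or> i = r - 1 \<and> j = r - 2"
proof -
  have "right_pos m i = pos m j \<Longrightarrow> i = 0 \<or> i = r - 1"
    using assms right_pos_in pos_mem by metis
  moreover have "right_pos m 0 = pos m j \<longleftrightarrow> j = r - 3" "right_pos m (r - 1) = pos m j \<longleftrightarrow> j = r - 2"
  proof -
    have "r - 3 < r" "r - 2 < r" using r_ge_5 by auto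
    then show "right_pos m 0 = pos m j \<longleftrightarrow> j = r - 3" "right_pos m (r - 1) = pos m j \<longleftrightarrow> j = r - 2"
      unfolding right_pos_ends using assms pos_eq_iff by metis+
  qed
  moreover have "0 \<noteq> r - 1" using r_ge_5 by simp
  ultimately show ?thesis by metis
qed

lemma left_pos_ne_right_pos: "i < r \<Longrightarrow> j < r \<Longrightarrow> left_pos m i \<noteq> right_pos m j"
proof -
  have "face_vs (m - 1) \<inter> face_vs (m + 1) = {}" using face_vs_Int_ne[of "m - 1" "m + 1"] by simp
  then show "i < r \<Longrightarrow> j < r \<Longrightarrow> left_pos m i \<noteq> right_pos m j"
    using left_pos_image[of m] right_pos_image[of m] by blast
qed

text \<open>Names \<open>(k, i)\<close> for the vertices of the corona, with \<open>k\<close> being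
  0, 1, 2 for the central, left and right face. The vertices on the two common rungs have two names
  each.\<close>

definition corona_pos :: "int \<Rightarrow> nat \<times> nat \<Rightarrow> nat" where
  "corona_pos m = (\<lambda>(k, i). (if k = 0 then pos m else if k = 1 then left_pos m else right_pos m) i)"

abbreviation corona_index :: "(nat \<times> nat) set" where
  "corona_index \<equiv> {..<3} \<times> {..<r}"

text \<open>Whether two names denote the same vertex is decided by conditions on the indices that
  mention neither the cell nor \<open>s\<close>; left and right neighbours are disjoint, so their
  sides never interact.\<close>

lemma corona_pos_eq_iff:
  assumes "a \<in> corona_index" "b \<in> corona_index"
  shows "corona_pos m a = corona_pos m b \<longleftrightarrow> corona_pos n a = corona_pos n b"
proof -
  obtain k i l j where ab: "a = (k, i)" "b = (l, j)" "i < r" "j < r" using assms by auto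
  have inj: "left_pos m i = left_pos m j \<longleftrightarrow> i = j" "right_pos m i = right_pos m j \<longleftrightarrow> i = j" for m
    using inj_left_pos inj_right_pos ab by (auto simp: inj_on_def)
  note eqs = inj pos_eq_iff[OF ab(3,4)] left_pos_eq_pos[OF ab(3,4)] left_pos_eq_pos[OF ab(4,3)]
    right_pos_eq_pos[OF ab(3,4)] right_pos_eq_pos[OF ab(4,3)]
    left_pos_ne_right_pos[OF ab(3,4)] left_pos_ne_right_pos[OF ab(4,3)]
  have sym: "pos m i = left_pos m j \<longleftrightarrow> left_pos m j = pos m i"
    "pos m i = right_pos m j \<longleftrightarrow> right_pos m j = pos m i"
    "right_pos m i = left_pos m j \<longleftrightarrow> left_pos m j = right_pos m i" for m by auto
  show ?thesis unfolding ab corona_pos_def by (simp add: eqs sym)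
qed

lemma corona_pos_simps: "corona_pos m (0, i) = pos m i" "corona_pos m (1, i) = left_pos m i"
  "corona_pos m (2, i) = right_pos m i"
  by (simp_all add: corona_pos_def)

lemma lessThan_3: "{..<3 :: nat} = {0, 1, 2}"
  by auto

lemma corona_pos_image: "corona_pos m ` corona_index = face_vs (m - 1) \<union> face_vs m \<union> face_vs (m + 1)"
proof -
  have "corona_pos m ` corona_index = (\<Union>k\<in>{..<3}. (\<lambda>i. corona_pos m (k, i)) ` {..<r})"
    by auto
  then show ?thesis
    unfolding lessThan_3 by (simp add: corona_pos_simps[simplified] pos_image left_pos_image right_pos_image Un_ac)
qed

end

text \<open>\<open>f\<close> and \<open>g\<close> identify the same indices, so sending each
  \<open>f a\<close> to \<open>g a\<close> is well defined and injective.\<close>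

lemma ex_transfer_map:
  assumes "\<And>a b. a \<in> I \<Longrightarrow> b \<in> I \<Longrightarrow> f a = f b \<longleftrightarrow> g a = g b"
  shows "\<exists>\<phi>. (\<forall>a\<in>I. \<phi> (f a) = g a) \<and> bij_betw \<phi> (f ` I) (g ` I)"
proof -
  define \<phi> where "\<phi> = g \<circ> inv_into I f"
  have eq: "\<phi> (f a) = g a" if "a \<in> I" for a
  proof -
    have "inv_into I f (f a) \<in> I" "f (inv_into I f (f a)) = f a"
      using that by (auto intro: inv_into_into f_inv_into_f)
    then show ?thesis using assms that by (auto simp: \<phi>_def)
  qed
  then have "bij_betw \<phi> (f ` I) (g ` I)"
    using assms by (auto simp: bij_betw_def inj_on_def image_image)
  then show ?thesis using eq by blast
qed

context ladder
begin

text \<open>The isomorphism matches equal names. It takes each of the three boundary cycles to its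
  counterpart, as all cycles are traversed by the same indices.\<close>

lemma same_coronas_G: "same_coronas G D"
  unfolding same_coronas_def interior_faces_G
proof (intro ballI)
  fix F F' assume "F \<in> range cell" "F' \<in> range cell"
  then obtain m n where F: "F = cell m" "F' = cell n" by blast
  obtain \<phi> where eq: "\<And>a. a \<in> corona_index \<Longrightarrow> \<phi> (corona_pos m a) = corona_pos n a"
      and bij: "bij_betw \<phi> (corona_pos m ` corona_index) (corona_pos n ` corona_index)"
    using ex_transfer_map[of corona_index "corona_pos m" "corona_pos n"] corona_pos_eq_iff by metis
  have fe: "face_edges G D (cell (m - 1)) = pos_edges (left_pos m)"
    "face_edges G D (cell (m + 1)) = pos_edges (right_pos m)" for m
    unfolding left_pos_def right_pos_def pos_edges_left_index pos_edges_right_index face_edges_cell by simp_all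
  have im: "(`) \<phi> ` face_edges G D (cell m) = face_edges G D (cell n)"
     "(`) \<phi> ` face_edges G D (cell (m - 1)) = face_edges G D (cell (n - 1))"
     "(`) \<phi> ` face_edges G D (cell (m + 1)) = face_edges G D (cell (n + 1))"
    \<comment> \<open>The neighbours must be rewritten to their relabelled traversals before the
      general equation, which also matches them, is applied to the central face.\<close>
    unfolding fe unfolding face_edges_cell pos_edges_image
    using eq[of "(0, _)"] eq[of "(1, _)"] eq[of "(2, _)"]
    by (auto simp: corona_pos_simps[simplified] intro!: pos_edges_cong)
  have "configuration_iso G D (corona G D F) (corona G D F') \<phi>"
    unfolding configuration_iso_def F corona_cell
  proof (intro conjI)
    show "bij_betw \<phi> (\<Union>F\<in>{cell (m - 1), cell m, cell (m + 1)}. face_verts G D F)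
       (\<Union>F\<in>{cell (n - 1), cell n, cell (n + 1)}. face_verts G D F)"
      using bij unfolding corona_pos_image by (simp add: face_verts_cell Un_assoc)
  qed (use im in \<open>auto simp: image_Un\<close>)
  then show "\<exists>\<phi>. configuration_iso G D (corona G D F) (corona G D F') \<phi> \<and>
      (`) \<phi> ` face_edges G D F = face_edges G D F'"
    using im F by blast
qed

lemma Union_face_edges_cell: "\<Union>(face_edges G D (cell n)) = face_vs n"
  by (simp add: face_edges_cell Union_pos_edges pos_image)

end

section \<open>Isomorphisms\<close>

lemma graph_iso_edge_iff:
  assumes "graph_iso \<phi> G H" "simple_graph G" "u \<in> verts G" "w \<in> verts G"
  shows "{\<phi> u, \<phi> w} \<in> edges H \<longleftrightarrow> {u, w} \<in> edges G"
proof
  have inj: "inj_on \<phi> (verts G)" and E: "(`) \<phi> ` edges G = edges H"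
    using assms(1) by (auto simp: graph_iso_def bij_betw_def)
  show "{\<phi> u, \<phi> w} \<in> edges H" if "{u, w} \<in> edges G"
  proof -
    have "\<phi> ` {u, w} \<in> (`) \<phi> ` edges G" using that by (rule imageI)
    then show ?thesis using E by simp
  qed
  assume "{\<phi> u, \<phi> w} \<in> edges H"
  then have "\<phi> ` {u, w} \<in> (`) \<phi> ` edges G" using E by simp
  then obtain e where e: "e \<in> edges G" "\<phi> ` e = \<phi> ` {u, w}" by (metis imageE)
  then have "e \<subseteq> verts G" using assms(2) by (auto simp: simple_graph_def)
  then have "e = {u, w}" using e(2) inj_on_image_eq_iff[OF inj, of e "{u, w}"] assms(3,4) by simp
  then show "{u, w} \<in> edges G" using e by simp
qed

lemma core_image:
  assumes "graph_iso \<phi> G H" "simple_graph G" "core G C"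
  shows "core H (\<phi> ` C)" "card (\<phi> ` C) = card C"
proof -
  have bij: "bij_betw \<phi> (verts G) (verts H)" using assms(1) by (simp add: graph_iso_def)
  have C: "finite C" "C \<noteq> {}" "C \<subseteq> verts G"
    and nb: "\<forall>v\<in>C. \<exists>a\<in>C. \<exists>b\<in>C. a \<noteq> b \<and> {v, a} \<in> edges G \<and> {v, b} \<in> edges G"
    using assms(3) unfolding core_def by blast+
  have inj: "inj_on \<phi> C" using bij C(3) by (meson bij_betw_def inj_on_subset)
  then show "card (\<phi> ` C) = card C" by (rule card_image)
  have "\<exists>a\<in>\<phi> ` C. \<exists>b\<in>\<phi> ` C. a \<noteq> b \<and> {\<phi> v, a} \<in> edges H \<and> {\<phi> v, b} \<in> edges H" if v: "v \<in> C" for v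
  proof -
    obtain a b where ab: "a \<in> C" "b \<in> C" "a \<noteq> b" "{v, a} \<in> edges G" "{v, b} \<in> edges G"
      using nb v by meson
    then have "{\<phi> v, \<phi> a} \<in> edges H" "{\<phi> v, \<phi> b} \<in> edges H"
      using graph_iso_edge_iff[OF assms(1,2)] v C(3) by blast+
    moreover have "\<phi> a \<noteq> \<phi> b" using inj ab by (auto simp: inj_on_def)
    ultimately show ?thesis using ab by blast
  qed
  moreover have "\<phi> ` C \<subseteq> verts H" using bij C(3) by (auto simp: bij_betw_def)
  ultimately show "core H (\<phi> ` C)" using C unfolding core_def by blast
qed

text \<open>Two successive steps of opposite sign would return to an earlier value, so injectivity
  keeps the direction constant.\<close>

lemma int_unit_steps:
  fixes \<pi> :: "int \<Rightarrow> int"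
  assumes inj: "inj \<pi>" and step: "\<And>n. \<bar>\<pi> (n + 1) - \<pi> n\<bar> = 1"
  shows "\<exists>c. (\<forall>n. \<pi> n = c + n) \<or> (\<forall>n. \<pi> n = c - n)"
proof -
  define d where "d n = \<pi> (n + 1) - \<pi> n" for n
  have d_Suc: "d (n + 1) = d n" for n
  proof (rule ccontr)
    assume "d (n + 1) \<noteq> d n"
    then have "\<pi> (n + 1 + 1) = \<pi> n" using step[of n] step[of "n + 1"] unfolding d_def by linarith
    then have "n + 1 + 1 = n" by (rule injD[OF inj])
    then show False by simp
  qed
  have d: "d n = d 0" for n
  proof (induction n rule: int_induct[where k = 0])
    case (step2 i)
    then show ?case using d_Suc[of "i - 1"] by simp
  qed (use d_Suc in simp_all)
  have \<pi>: "\<pi> n = \<pi> 0 + d 0 * n" for n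
  proof (induction n rule: int_induct[where k = 0])
    case (step1 i)
    then show ?case using d[of i] by (simp add: d_def algebra_simps)
  next
    case (step2 i)
    then show ?case using d[of "i - 1"] by (simp add: d_def algebra_simps)
  qed simp
  have "d 0 = 1 \<or> d 0 = -1" using step[of 0] by (auto simp: d_def)
  then show ?thesis
  proof
    assume "d 0 = 1"
    then have "\<pi> n = \<pi> 0 + n" for n using \<pi>[of n] by simp
    then show ?thesis by blast
  next
    assume "d 0 = -1"
    then have "\<pi> n = \<pi> 0 - n" for n using \<pi>[of n] by simp
    then show ?thesis by blast
  qed
qed

locale ladder_iso = A: ladder r s + B: ladder r t for r s t +
  fixes \<phi> :: "nat \<Rightarrow> nat"
  assumes iso: "graph_iso \<phi> A.G B.G"
begin

lemma inj_on_verts: "inj_on \<phi> (verts A.G)"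
  using iso by (simp add: graph_iso_def bij_betw_def)

lemma face_vs_image: "\<exists>m. \<phi> ` A.face_vs n = B.face_vs m"
proof -
  have "core B.G (\<phi> ` A.face_vs n) \<and> card (\<phi> ` A.face_vs n) = r"
    using core_image[OF iso A.simple_graph_G A.core_face_vs[of n]] A.card_face_vs[of n] by simp
  then show ?thesis unfolding B.core_card_iff .
qed

text \<open>Faces go to faces, and consecutive faces meet, so the induced injective map on indices
  makes unit steps.\<close>

lemma ex_face_permutation:
  obtains c where "\<And>n. \<phi> ` A.face_vs n = B.face_vs (c + n)"
    | c where "\<And>n. \<phi> ` A.face_vs n = B.face_vs (c - n)"
proof -
  obtain \<pi> where \<pi>: "\<And>n. \<phi> ` A.face_vs n = B.face_vs (\<pi> n)" using face_vs_image by metis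
  have inj: "inj \<pi>"
  proof (rule injI)
    fix n m assume "\<pi> n = \<pi> m"
    then have "\<phi> ` A.face_vs n = \<phi> ` A.face_vs m" using \<pi> by simp
    then show "n = m"
      using inj_on_image_eq_iff[OF inj_on_verts A.face_vs_subset A.face_vs_subset] A.face_vs_inj by simp
  qed
  have "\<bar>\<pi> (n + 1) - \<pi> n\<bar> = 1" for n
  proof -
    have "A.face_vs (n + 1) \<inter> A.face_vs n \<noteq> {}" using A.face_vs_Int_ne[of "n + 1" n] by simp
    then have "B.face_vs (\<pi> (n + 1)) \<inter> B.face_vs (\<pi> n) \<noteq> {}" using \<pi> by blast
    then have "\<bar>\<pi> (n + 1) - \<pi> n\<bar> \<le> 1" using B.face_vs_Int_ne by simp
    moreover have "\<pi> (n + 1) \<noteq> \<pi> n" using inj by (simp add: inj_eq)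
    ultimately show ?thesis by linarith
  qed
  then show ?thesis using int_unit_steps[OF inj] \<pi> that by metis
qed

text \<open>\<open>straight\<close> is phrased through vertex sets of faces and edges alone, both of
  which the isomorphism transports.\<close>

lemma straight_image:
  assumes "\<And>n. \<phi> ` A.face_vs n = B.face_vs (\<pi> n)"
  shows "B.straight (\<pi> i) (\<pi> j) (\<pi> k) (\<pi> l) \<longleftrightarrow> A.straight i j k l"
proof -
  have int: "B.face_vs (\<pi> i) \<inter> B.face_vs (\<pi> j) = \<phi> ` (A.face_vs i \<inter> A.face_vs j)" for i j
    unfolding assms[symmetric]
    using inj_on_image_Int[OF inj_on_verts A.face_vs_subset A.face_vs_subset] by simp
  have e: "{\<phi> u, \<phi> w} \<in> edges B.G \<longleftrightarrow> {u, w} \<in> edges A.G"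
    if "u \<in> A.face_vs i" "w \<in> A.face_vs j" for u w i j
    using graph_iso_edge_iff[OF iso A.simple_graph_G] that A.face_vs_subset by blast
  show ?thesis
    unfolding A.straight_def B.straight_def int bex_simps ball_simps
    by (intro bex_cong refl conj_cong) (auto dest: e)
qed

theorem shift_or_reflection:
  obtains (shift) c where "\<And>n. \<phi> ` A.face_vs n = B.face_vs (c + n)"
      "\<And>n. s n = s (n + 1) \<longleftrightarrow> t (c + n) = t (c + n + 1)"
    | (reflection) c where "\<And>n. \<phi> ` A.face_vs n = B.face_vs (c - n)"
      "\<And>n. s n = s (n + 1) \<longleftrightarrow> t (c - n - 1) = t (c - n)"
proof (rule ex_face_permutation)
  fix c assume c: "\<And>n. \<phi> ` A.face_vs n = B.face_vs (c + n)"
  have "s n = s (n + 1) \<longleftrightarrow> t (c + n) = t (c + n + 1)" for n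
    using straight_image[OF c, of "n - 1" n "n + 1" "n + 2"] A.straight_iff[of n] B.straight_iff[of "c + n"]
    by (simp add: add.assoc add_diff_eq)
  then show thesis using c shift by blast
next
  fix c assume c: "\<And>n. \<phi> ` A.face_vs n = B.face_vs (c - n)"
  have "s n = s (n + 1) \<longleftrightarrow> t (c - n - 1) = t (c - n)" for n
  proof -
    \<comment> \<open>A reflection sends the faces \<open>n\<close> and \<open>n + 1\<close> to
      \<open>c - n\<close> and \<open>c - n - 1\<close>, so the criterion is applied in
      \<open>B\<close> at \<open>c - n - 1\<close>.\<close>
    have "c - (n + 2) = c - n - 1 - 1" "c - (n + 1) = c - n - 1" "c - n = c - n - 1 + 1"
      "c - (n - 1) = c - n - 1 + 2" by auto
    then have "s n = s (n + 1) \<longleftrightarrow> B.straight (c - n - 1 - 1) (c - n - 1) (c - n - 1 + 1) (c - n - 1 + 2)"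
      using straight_image[OF c, of "n + 2" "n + 1" n "n - 1"] A.straight_iff[of n] A.straight_sym by metis
    then show ?thesis using B.straight_iff[of "c - n - 1"] by simp
  qed
  then show thesis using c reflection by blast
qed

end

section \<open>Encoding sets of naturals by short sides\<close>

text \<open>Constantly \<open>True\<close> to the left of 0, then blocks of three:
  \<open>False\<close>, \<open>True\<close>, and the membership bit of the block number. The two
  fixed entries produce a change in every block, whatever the set is.\<close>

definition pattern :: "nat set \<Rightarrow> int \<Rightarrow> bool" where
  "pattern S n \<longleftrightarrow> n < 0 \<or> n mod 3 = 1 \<or> n mod 3 = 2 \<and> nat (n div 3) \<in> S"

lemma pattern_change: "k \<ge> 0 \<Longrightarrow> pattern S (3 * k) \<noteq> pattern S (3 * k + 1)" "pattern S (-1) \<noteq> pattern S 0"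
  by (simp_all add: pattern_def)

lemma pattern_const: "n \<le> -2 \<Longrightarrow> pattern S n = pattern S (n + 1)"
  by (simp add: pattern_def)

text \<open>Seen from the left, the first change of a pattern is the one from \<open>-1\<close> to \<open>0\<close>, which excludes
  proper shifts; reflections are excluded since there are changes arbitrarily far to the right.\<close>

lemma pattern_no_reflection:
  "\<not> (\<forall>n. pattern S n = pattern S (n + 1) \<longleftrightarrow> pattern T (c - n - 1) = pattern T (c - n))"
proof
  assume *: "\<forall>n. pattern S n = pattern S (n + 1) \<longleftrightarrow> pattern T (c - n - 1) = pattern T (c - n)"
  \<comment> \<open>A multiple of 3, hence a place of change in \<open>S\<close>, and so large that
    its mirror image falls into the constant part of \<open>T\<close>.\<close>
  define n where "n = 3 * (\<bar>c\<bar> + 1)"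
  have "pattern S n \<noteq> pattern S (n + 1)" unfolding n_def by (intro pattern_change) simp
  then have "pattern T (c - n - 1) \<noteq> pattern T (c - n)" using * by blast
  moreover have "c - n - 1 \<le> -2"
    using abs_ge_self[of c] abs_ge_zero[of c] unfolding n_def distrib_left by linarith
  ultimately show False using pattern_const[of "c - n - 1" T] by simp
qed

lemma pattern_shift:
  assumes *: "\<And>n. pattern S n = pattern S (n + 1) \<longleftrightarrow> pattern T (c + n) = pattern T (c + n + 1)"
  shows "c = 0" "S = T"
proof -
  \<comment> \<open>The first change of \<open>S\<close> is carried to \<open>c - 1\<close>, which
    cannot lie before the first change of \<open>T\<close>, so \<open>c \<ge> 0\<close>. Exchanging
    the roles gives \<open>c \<le> 0\<close>.\<close>
  have "pattern T (c - 1) \<noteq> pattern T c" using *[of "-1"] pattern_change(2)[of S] by simp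
  then have "\<not> c - 1 \<le> -2" using pattern_const[of "c - 1" T] by auto
  moreover have "pattern S (- 1 - c) \<noteq> pattern S (- c)" using *[of "-1 - c"] pattern_change(2)[of T] by simp
  then have "\<not> - 1 - c \<le> -2" using pattern_const[of "- 1 - c" S] by auto
  ultimately show c: "c = 0" by linarith
  \<comment> \<open>Both sequences are \<open>False\<close> at 0, and from there the places of
    change determine them.\<close>
  have eq: "pattern S (int k) = pattern T (int k)" for k
  proof (induction k)
    case 0
    then show ?case by (simp add: pattern_def)
  next
    case (Suc k)
    then show ?case using *[of "int k"] c by (simp add: add.commute) blast
  qed
  have "k \<in> S \<longleftrightarrow> pattern S (int (3 * k + 2))" for k S
  proof -
    have "int (3 * k + 2) mod 3 = 2" "int (3 * k + 2) div 3 = int k" by simp_all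
    then show ?thesis by (simp add: pattern_def)
  qed
  then show "S = T" using eq by blast
qed

text \<open>The first conclusion separates the graphs of different sets. The second, used with equal
  sets, says that automorphisms fix every face, which is how isohedrality is refuted.\<close>

lemma ladder_pattern_iso:
  assumes "r \<ge> 5" "graph_iso \<phi> (ladder.G r (pattern S)) (ladder.G r (pattern T))"
  shows "S = T" "\<phi> ` ladder.face_vs r (pattern S) n = ladder.face_vs r (pattern T) n"
proof -
  interpret ladder_iso r "pattern S" "pattern T" \<phi>
    using assms by unfold_locales auto
  have "S = T \<and> \<phi> ` A.face_vs n = B.face_vs n"
  proof (rule shift_or_reflection)
    fix c assume c: "\<And>n. \<phi> ` A.face_vs n = B.face_vs (c + n)"
      "\<And>n. pattern S n = pattern S (n + 1) \<longleftrightarrow> pattern T (c + n) = pattern T (c + n + 1)"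
    show ?thesis using pattern_shift[OF c(2)] c(1)[of n] by simp
  qed (use pattern_no_reflection in blast)
  then show "S = T" "\<phi> ` A.face_vs n = B.face_vs n" by auto
qed

lemma not_isohedral_pattern:
  assumes "r \<ge> 5"
  shows "\<not> isohedral (ladder.G r (pattern S)) D"
proof
  interpret ladder r "pattern S" using assms by unfold_locales
  assume "isohedral G D"
  then have "\<exists>\<phi>. polycycle_automorphism G D \<phi> \<and>
      (`) \<phi> ` face_edges G D (cell 0) = face_edges G D (cell 1)"
    unfolding isohedral_def interior_faces_G by (meson rangeI)
  then obtain \<phi> where \<phi>: "graph_iso \<phi> G G"
      "(`) \<phi> ` face_edges G D (cell 0) = face_edges G D (cell 1)"
    unfolding polycycle_automorphism_def by meson
  have "\<phi> ` face_vs 0 = face_vs 1"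
    unfolding Union_face_edges_cell[symmetric] \<phi>(2)[symmetric] image_Union ..
  then show False using ladder_pattern_iso(2)[OF assms \<phi>(1), of 0] face_vs_inj[of 0 1] by simp
qed

theorem mainTheorem6:
  fixes r :: nat
  assumes "r \<ge> 5"
  shows "\<exists>\<G> :: nat graph set.
           \<G> \<approx> (UNIV :: real set) \<and>
           (\<forall>G\<in>\<G>. \<exists>q. quasi_isohedral_polycycle r q G) \<and>
           pairwise (\<lambda>G H. \<not> isomorphic G H) \<G>"
proof (intro exI conjI)
  let ?G = "\<lambda>S. ladder.G r (pattern S)"
  have iso: "S = T" if "isomorphic (?G S) (?G T)" for S T
    using that ladder_pattern_iso(1)[OF assms] by (auto simp: isomorphic_def)
  have refl: "isomorphic G G" for G :: "nat graph"
    unfolding isomorphic_def graph_iso_def by (intro exI[of _ id]) simp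
  have "inj ?G"
  proof (rule injI)
    fix S T assume "?G S = ?G T"
    then have "isomorphic (?G S) (?G T)" using refl[of "?G T"] by simp
    then show "S = T" by (rule iso)
  qed
  then have "range ?G \<approx> (UNIV :: nat set set)" by (rule inj_on_image_eqpoll_self)
  then show "range ?G \<approx> (UNIV :: real set)" using nat_sets_eqpoll_reals eqpoll_trans by blast
  show "\<forall>G\<in>range ?G. \<exists>q. quasi_isohedral_polycycle r q G"
  proof
    fix G assume "G \<in> range ?G"
    then obtain S where G: "G = ?G S" by blast
    interpret ladder r "pattern S" using assms by unfold_locales
    show "\<exists>q. quasi_isohedral_polycycle r q G"
      unfolding G quasi_isohedral_polycycle_def
      using polycycle_G polycyclic_realization_G not_isohedral_pattern[OF assms] same_coronas_G by blast
  qed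
  show "pairwise (\<lambda>G H. \<not> isomorphic G H) (range ?G)"
    using iso by (auto simp: pairwise_def)
qed

end
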